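(* Let $1\le p<\infty$, $N,M\in\mathbb N$, let $E\subset \mathfrak{LC}_p(\mathbb R^M)$ admit $L^p_{loc}$-bounded $l$-bounds, let $D$ be a countable dense subset of $\mathbb R^N$, and let $\mathcal T$ be any of the topologies $\mathcal T_{D}$, $\mathcal T_\Theta$ ($\Theta$ a suitable set of moduli of continuity), $\mathcal T_B$. The following statements are equivalent. (i) $E$ is relatively compact in $(\mathfrak{LC}_p(\mathbb R^M),\mathcal T)$. (ii) For any fixed $x\in D$ the set $\{f(\cdot,x)\mid f\in E\}$ is relatively compact in $L^p_{loc}(\mathbb R^M)$.
   Context: $B_j$ is the closed ball of radius $j$ centered at $0$ in $\mathbb R^N$. $L^p_{loc}(\mathbb R^M)$ is the space of functions $\mathbb R\to\mathbb R^M$ belonging to $L^p(I,\mathbb R^M)$ for every compact interval $I$, with the topology of $L^p$ convergence on compact intervals; $L^p_{loc}=L^p_{loc}(\mathbb R)$. A set is relatively compact if its closure is compact. $\mathfrak{LC}_p(\mathbb R^M)$ is the set of $f:\mathbb R\times\mathbb R^N\to\mathbb R^M$ such that: (C1) $f$ is Borel measurable; (C2) for every compact $K\subset\mathbb R^N$ there is $m^K\in L^p_{loc}$ with $|f(t,x)|\le m^K(t)$ for a.e. $t$ and all $x\in K$; (L) for every compact $K\subset\mathbb R^N$ there is $l^K\in L^p_{loc}$ with $|f(t,x)-f(t,y)|\le l^K(t)|x-y|$ for a.e. $t$ and all $x,y\in K$. Functions in this space differing only on a Lebesgue-null subset of $\mathbb R^{1+N}$ are identified. The optimal $l$-bound of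 $f\in\mathfrak{LC}_p(\mathbb R^M)$ on $B_j$ is $l^j_f(t)=\sup_{x,y\in B_j,\,x\ne y}|f(t,x)-f(t,y)|/|x-y|$. A set $E\subset\mathfrak{LC}_p(\mathbb R^M)$ admits $L^p_{loc}$-bounded $l$-bounds if $\sup_{f\in E}\int_{-r}^r (l^j_f(t))^p\,dt<\infty$ for every $j\in\mathbb N$ and $r>0$. A suitable set of moduli of continuity is a countable set of non-decreasing continuous functions $\Theta=\{\theta^I_j:[0,\infty)\to[0,\infty)\mid j\in\mathbb N,\ I=[q_1,q_2],\ q_1,q_2\in\mathbb Q\}$ with $\theta^I_j(0)=0$ and $\theta^{I_1}_{j_1}\le\theta^{I_2}_{j_2}$ whenever $I_1\subseteq I_2$, $j_1\le j_2$; $\mathcal K^I_j$ is the set of continuous functions $I\to B_j$ admitting $\theta^I_j$ as modulus of continuity. Topologies on $\mathfrak{LC}_p(\mathbb R^M)$, with $I$ ranging over compact intervals with rational endpoints and $j\in\mathbb N$: $\mathcal T_B$ is generated by the seminorms $\sup_{x(\cdot)\in C(I,B_j)}\big[\int_I|f(t,x(t))|^pdt\big]^{1/p}$; $\mathcal T_\Theta$ by $\sup_{x(\cdot)\in\mathcal K^I_j}\big[\int_I|f(t,x(t))|^pdt\big]^{1/p}$; $\mathcal T_D$ by $\big[\int_I|f(t,x)|^pdt\big]^{1/p}$, $x\in D$. *)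

theory Defs
  imports "HOL-Analysis.Analysis"
begin

text \<open>
  Spaces of functions modulo almost everywhere equality are sets of equivalence classes,
  each class being a set of functions. All seminorms below, the \<open>l\<close>-bounds up to a null set
  of times, and the slices \<open>f(\<cdot>,x)\<close> up to almost everywhere equality, do not depend on the
  chosen representative: by Fubini and the local Lipschitz condition, two members
  of a class of \<open>LC_space p\<close> satisfy \<open>f(t,\<cdot>) = g(t,\<cdot>)\<close> everywhere for almost every \<open>t\<close>.
\<close>

definition representative :: "'a set \<Rightarrow> 'a"
  where "representative F = (SOME f. f \<in> F)"

text \<open>The topology on the set \<open>X\<close> of classes having as a subbase all balls
  \<open>{G \<in> X. q (G - F) < e}\<close> with \<open>q\<close> in the family \<open>Q\<close> of seminorms.\<close>

definition seminorm_topology ::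
    "('a \<Rightarrow> 'b::real_vector) set set \<Rightarrow> (('a \<Rightarrow> 'b) \<Rightarrow> real) set \<Rightarrow> ('a \<Rightarrow> 'b) set topology"
  where "seminorm_topology X Q = topology_generated_by
    (insert X {{G \<in> X. q (\<lambda>z. representative G z - representative F z) < e} | F q e.
       F \<in> X \<and> q \<in> Q \<and> 0 < e})"

definition relatively_compact_in :: "'a topology \<Rightarrow> 'a set \<Rightarrow> bool"
  where "relatively_compact_in T A \<longleftrightarrow> A \<subseteq> topspace T \<and> compactin T (T closure_of A)"

definition Lp_seminorm :: "real \<Rightarrow> real set \<Rightarrow> (real \<Rightarrow> 'b::euclidean_space) \<Rightarrow> real"
  where "Lp_seminorm p I f = (LINT t:I|lebesgue. norm (f t) powr p) powr (1 / p)"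

definition Lp_loc_functions :: "real \<Rightarrow> (real \<Rightarrow> 'b::euclidean_space) set"
  where "Lp_loc_functions p = {f. \<forall>a b. f \<in> borel_measurable (lebesgue_on {a..b}) \<and>
    integrable (lebesgue_on {a..b}) (\<lambda>t. norm (f t) powr p)}"

definition Lp_loc_rel ::
    "real \<Rightarrow> ((real \<Rightarrow> 'b::euclidean_space) \<times> (real \<Rightarrow> 'b)) set"
  where "Lp_loc_rel p = {(f, g). f \<in> Lp_loc_functions p \<and> g \<in> Lp_loc_functions p \<and>
    (AE t in lebesgue. f t = g t)}"

definition Lp_loc_space :: "real \<Rightarrow> (real \<Rightarrow> 'b::euclidean_space) set set"
  where "Lp_loc_space p = Lp_loc_functions p // Lp_loc_rel p"

definition Lp_loc_topology :: "real \<Rightarrow> (real \<Rightarrow> 'b::euclidean_space) set topology"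
  where "Lp_loc_topology p =
    seminorm_topology (Lp_loc_space p) {Lp_seminorm p {a..b} | a b. a \<le> b}"

definition LC_functions :: "real \<Rightarrow> (real \<times> (real ^ 'n) \<Rightarrow> real ^ 'm) set"
  where "LC_functions p = {f. f \<in> borel_measurable borel \<and>
    (\<forall>K. compact K \<longrightarrow> (\<exists>m \<in> Lp_loc_functions p.
       AE t in lebesgue. \<forall>x\<in>K. norm (f (t, x)) \<le> m t)) \<and>
    (\<forall>K. compact K \<longrightarrow> (\<exists>l \<in> Lp_loc_functions p.
       AE t in lebesgue. \<forall>x\<in>K. \<forall>y\<in>K. norm (f (t, x) - f (t, y)) \<le> l t * norm (x - y)))}"

definition LC_rel ::
    "real \<Rightarrow> ((real \<times> (real ^ 'n) \<Rightarrow> real ^ 'm) \<times> (real \<times> (real ^ 'n) \<Rightarrow> real ^ 'm)) set"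
  where "LC_rel p = {(f, g). f \<in> LC_functions p \<and> g \<in> LC_functions p \<and>
    (AE z in lebesgue. f z = g z)}"

definition LC_space :: "real \<Rightarrow> (real \<times> (real ^ 'n) \<Rightarrow> real ^ 'm) set set"
  where "LC_space p = LC_functions p // LC_rel p"

text \<open>The class of \<open>f(\<cdot>,x)\<close> in \<open>Lp_loc_space p\<close>.\<close>

definition slice ::
    "real \<Rightarrow> real ^ 'n \<Rightarrow> (real \<times> (real ^ 'n) \<Rightarrow> real ^ 'm) set \<Rightarrow> (real \<Rightarrow> real ^ 'm) set"
  where "slice p x F = Lp_loc_rel p `` {\<lambda>t. representative F (t, x)}"

text \<open>The optimal \<open>l\<close>-bound may be infinite on a null set of times, hence takes values in
  \<^typ>\<open>ennreal\<close>; for \<open>j = 0\<close> the supremum is over the empty set and equals 0.\<close>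

definition l_bound ::
    "(real \<times> (real ^ 'n) \<Rightarrow> real ^ 'm) \<Rightarrow> nat \<Rightarrow> real \<Rightarrow> ennreal"
  where "l_bound f j t =
    (SUP (x, y) \<in> {(x, y). x \<in> cball 0 (real j) \<and> y \<in> cball 0 (real j) \<and> x \<noteq> y}.
       ennreal (norm (f (t, x) - f (t, y)) / norm (x - y)))"

definition ennreal_powr :: "ennreal \<Rightarrow> real \<Rightarrow> ennreal"
  where "ennreal_powr a p = (if a = \<infinity> then \<infinity> else ennreal (enn2real a powr p))"

definition Lp_loc_bounded_l_bounds ::
    "real \<Rightarrow> (real \<times> (real ^ 'n) \<Rightarrow> real ^ 'm) set set \<Rightarrow> bool"
  where "Lp_loc_bounded_l_bounds p E \<longleftrightarrow> (\<forall>j. \<forall>r>0.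
    (SUP F\<in>E. \<integral>\<^sup>+t\<in>{-r..r}. ennreal_powr (l_bound (representative F) j t) p \<partial>lebesgue) < \<infinity>)"

definition rational_intervals :: "real set set"
  where "rational_intervals = {{q1..q2} | q1 q2. q1 \<in> \<rat> \<and> q2 \<in> \<rat> \<and> q1 \<le> q2}"

text \<open>The functions \<open>\<theta> I j\<close> are defined on the whole line; only their restrictions to
  \<open>[0,\<infinity>)\<close> matter.\<close>

definition suitable_moduli :: "(real set \<Rightarrow> nat \<Rightarrow> real \<Rightarrow> real) \<Rightarrow> bool"
  where "suitable_moduli \<theta> \<longleftrightarrow>
    (\<forall>I\<in>rational_intervals. \<forall>j. \<theta> I j ` {0..} \<subseteq> {0..} \<and> mono_on {0..} (\<theta> I j) \<and>
       continuous_on {0..} (\<theta> I j) \<and> \<theta> I j 0 = 0) \<and>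
    (\<forall>I1\<in>rational_intervals. \<forall>I2\<in>rational_intervals. \<forall>j1 j2.
       I1 \<subseteq> I2 \<and> j1 \<le> j2 \<longrightarrow> (\<forall>s\<ge>0. \<theta> I1 j1 s \<le> \<theta> I2 j2 s))"

definition continuous_curves :: "real set \<Rightarrow> nat \<Rightarrow> (real \<Rightarrow> real ^ 'n) set"
  where "continuous_curves I j = {x. continuous_on I x \<and> x ` I \<subseteq> cball 0 (real j)}"

definition modulus_curves ::
    "(real set \<Rightarrow> nat \<Rightarrow> real \<Rightarrow> real) \<Rightarrow> real set \<Rightarrow> nat \<Rightarrow> (real \<Rightarrow> real ^ 'n) set"
  where "modulus_curves \<theta> I j = {x \<in> continuous_curves I j.
    \<forall>s\<in>I. \<forall>t\<in>I. norm (x s - x t) \<le> \<theta> I j \<bar>s - t\<bar>}"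

text \<open>The suprema below are suprema of nonempty sets of reals, bounded because of
  the locally integrable bounds required in \<open>LC_functions\<close>.\<close>

definition curve_seminorm ::
    "real \<Rightarrow> real set \<Rightarrow> (real \<Rightarrow> real ^ 'n) set \<Rightarrow> (real \<times> (real ^ 'n) \<Rightarrow> real ^ 'm) \<Rightarrow> real"
  where "curve_seminorm p I C f = (SUP x\<in>C. Lp_seminorm p I (\<lambda>t. f (t, x t)))"

definition T_B :: "real \<Rightarrow> (real \<times> (real ^ 'n) \<Rightarrow> real ^ 'm) set topology"
  where "T_B p = seminorm_topology (LC_space p)
    {curve_seminorm p I (continuous_curves I j) | I j. I \<in> rational_intervals}"

definition T_Theta ::
    "real \<Rightarrow> (real set \<Rightarrow> nat \<Rightarrow> real \<Rightarrow> real) \<Rightarrow> (real \<times> (real ^ 'n) \<Rightarrow> real ^ 'm) set topology"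
  where "T_Theta p \<theta> = seminorm_topology (LC_space p)
    {curve_seminorm p I (modulus_curves \<theta> I j) | I j. I \<in> rational_intervals}"

definition T_D ::
    "real \<Rightarrow> (real ^ 'n) set \<Rightarrow> (real \<times> (real ^ 'n) \<Rightarrow> real ^ 'm) set topology"
  where "T_D p D = seminorm_topology (LC_space p)
    {(\<lambda>f. Lp_seminorm p I (\<lambda>t. f (t, x))) | I x. I \<in> rational_intervals \<and> x \<in> D}"

end

theory Submission
  imports Defs "HOL-Library.Diagonal_Subsequence"
begin

text \<open>
  All the topologies involved are metrizable, being generated by countably many pseudometrics
  that separate points (\<open>relatively_compact_in_seminorm_topology_iff\<close>). Relative compactness
  therefore means that every sequence has a convergent subsequence, and the three topologies
  \<open>T_D\<close>, \<open>T_Theta\<close> and \<open>T_B\<close> can be treated at once: the seminorms are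
  suprema of the \<open>p\<close>-norms of \<open>f(\<cdot>, x(\<cdot>))\<close> over countably many sets of continuous curves
  \<open>x(\<cdot>)\<close>, among them the constant curves through \<open>D\<close> (\<open>topology_from_curve_family\<close>).

  Since the seminorms dominate the norms along constant curves, convergence in the topology implies
  convergence of all slices at points of \<open>D\<close>, and compactness passes to the slices.

  For the converse, take a sequence in \<open>E\<close>. A diagonal argument gives a subsequence \<open>f n\<close> whose
  slices at all points of \<open>D\<close> converge in norm on bounded intervals and almost everywhere
  (\<open>subsequence_converging_on_dense\<close>). Two things remain.

  First, the limits on the lines through \<open>D\<close> must come from one function in the space. Let \<open>\<rho> n\<close>
  be Lipschitz bounds of \<open>f n\<close> on a ball with bounded integrals of \<open>(\<rho> n)\<^sup>p\<close>. By Fatou's lemma the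
  lower limit of \<open>(\<rho> n)\<^sup>p\<close> is locally integrable, and for almost every \<open>t\<close> the pointwise
  limit is Lipschitz on the points of \<open>D\<close> in the ball, with the \<open>p\<close>-th root of this lower limit as its constant. It
  extends to a locally Lipschitz function of the whole space (\<open>limit_in_LC_functions\<close>).

  Second, convergence on \<open>D\<close> must imply convergence uniformly along all curves in a ball
  (\<open>curve_convergence_if_dense_convergence\<close>). For a finite net of mesh \<open>\<delta>\<close> in the ball, consisting
  of points of \<open>D\<close>, the difference along any curve is at most the sum of the differences at
  the points of the net plus \<open>\<delta>\<close> times Lipschitz bounds, which are bounded in
  \<open>p\<close>-norm. The net is chosen first, then the index \<open>n\<close>.
\<close>

section \<open>Countable families of pseudometrics\<close>

locale pseudometric_sequence =
  fixes X :: "'c set" and \<delta> :: "nat \<Rightarrow> 'c \<Rightarrow> 'c \<Rightarrow> real"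
  assumes self_zero: "x \<in> X \<Longrightarrow> \<delta> k x x = 0"
    and symmetric: "x \<in> X \<Longrightarrow> y \<in> X \<Longrightarrow> \<delta> k x y = \<delta> k y x"
    and triangle: "x \<in> X \<Longrightarrow> y \<in> X \<Longrightarrow> z \<in> X \<Longrightarrow> \<delta> k x z \<le> \<delta> k x y + \<delta> k y z"
    and separating: "x \<in> X \<Longrightarrow> y \<in> X \<Longrightarrow> (\<And>k. \<delta> k x y = 0) \<Longrightarrow> x = y"
begin

lemma component_nonneg: "x \<in> X \<Longrightarrow> y \<in> X \<Longrightarrow> 0 \<le> \<delta> k x y"
  using triangle[of x y x k] symmetric[of x y k] self_zero[of x k] by simp

text \<open>A metric for the coarsest topology in which all the pseudometrics are continuous. With a
  supremum instead of a weighted series, an upper bound for the distance is equivalent to an upper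
  bound for each truncated pseudometric.\<close>

definition sup_dist :: "'c \<Rightarrow> 'c \<Rightarrow> real"
  where "sup_dist x y =
    (if x \<in> X \<and> y \<in> X then SUP k. min (1 / real (Suc k)) (\<delta> k x y) else 0)"

lemma sup_dist_le_iff:
  assumes "x \<in> X" "y \<in> X"
  shows "sup_dist x y \<le> e \<longleftrightarrow> (\<forall>k. min (1 / real (Suc k)) (\<delta> k x y) \<le> e)"
proof -
  have "bdd_above (range (\<lambda>k. min (1 / real (Suc k)) (\<delta> k x y)))"
    by (rule bdd_aboveI[of _ 1]) (auto simp: min_le_iff_disj)
  then show ?thesis
    using assms by (simp add: sup_dist_def cSUP_le_iff)
qed

lemma component_le_sup_dist:
  "x \<in> X \<Longrightarrow> y \<in> X \<Longrightarrow> min (1 / real (Suc k)) (\<delta> k x y) \<le> sup_dist x y"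
  using sup_dist_le_iff by blast

lemma sup_dist_nonneg: "0 \<le> sup_dist x y"
proof (cases "x \<in> X \<and> y \<in> X")
  case True
  then have "0 \<le> min (1 / real (Suc 0)) (\<delta> 0 x y)"
    using component_nonneg by simp
  also have "\<dots> \<le> sup_dist x y"
    using True component_le_sup_dist by blast
  finally show ?thesis .
qed (auto simp: sup_dist_def)

lemma component_less:
  assumes "x \<in> X" "y \<in> X" "sup_dist x y < e" "e \<le> 1 / real (Suc k)"
  shows "\<delta> k x y < e"
  using component_le_sup_dist[OF assms(1,2), of k] assms(3,4) by (auto simp: min_def split: if_splits)

sublocale Metric_space X sup_dist
proof
  fix x y z
  show "0 \<le> sup_dist x y"
    by (rule sup_dist_nonneg)
  show "sup_dist x y = sup_dist y x"
    by (auto simp: sup_dist_def symmetric)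
  assume x: "x \<in> X" and y: "y \<in> X"
  show "sup_dist x y = 0 \<longleftrightarrow> x = y"
  proof
    assume "sup_dist x y = 0"
    then have "\<delta> k x y = 0" for k
      using component_le_sup_dist[OF x y, of k] component_nonneg[OF x y, of k]
      by (auto simp: min_def split: if_splits)
    then show "x = y"
      using x y separating by blast
  next
    assume "x = y"
    then have "sup_dist x y \<le> 0"
      using x y by (subst sup_dist_le_iff) (auto simp: self_zero)
    then show "sup_dist x y = 0"
      using sup_dist_nonneg[of x y] by simp
  qed
  assume z: "z \<in> X"
  show "sup_dist x z \<le> sup_dist x y + sup_dist y z"
      unfolding sup_dist_le_iff[OF x z]
  proof
    have truncation: "min c a \<le> min c u + min c v"
      if "a \<le> u + v" "0 \<le> u" "0 \<le> v" "0 \<le> c" for a c u v :: real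
      using that by (auto simp: min_def)
    fix k
    have "min (1 / real (Suc k)) (\<delta> k x z)
        \<le> min (1 / real (Suc k)) (\<delta> k x y) + min (1 / real (Suc k)) (\<delta> k y z)"
      using triangle[OF x y z, of k] component_nonneg[OF x y, of k] component_nonneg[OF y z, of k]
      by (intro truncation) auto
    also have "\<dots> \<le> sup_dist x y + sup_dist y z"
      using component_le_sup_dist[OF x y] component_le_sup_dist[OF y z] by (intro add_mono)
    finally show "min (1 / real (Suc k)) (\<delta> k x z) \<le> sup_dist x y + sup_dist y z" .
  qed
qed

text \<open>Because the \<open>k\<close>-th pseudometric is truncated at \<open>1 / (k + 1)\<close>, a ball of
  radius \<open>e\<close> constrains only the finitely many pseudometrics with \<open>k < 1 / e\<close>.\<close>

lemma finitely_many_components_suffice: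
  assumes "0 < e"
  obtains n where "\<And>x y. x \<in> X \<Longrightarrow> y \<in> X \<Longrightarrow> (\<And>k. k < n \<Longrightarrow> \<delta> k x y < e) \<Longrightarrow> sup_dist x y \<le> e"
proof -
  obtain n where n: "1 / real (Suc n) < e"
    using assms nat_approx_posE by blast
  show ?thesis
  proof (rule that[of n])
    fix x y
    assume xy: "x \<in> X" "y \<in> X" and small: "\<And>k. k < n \<Longrightarrow> \<delta> k x y < e"
    show "sup_dist x y \<le> e"
      unfolding sup_dist_le_iff[OF xy]
    proof
      fix k
      show "min (1 / real (Suc k)) (\<delta> k x y) \<le> e"
      proof (cases "k < n")
        case True
        then show ?thesis
          using small[OF True] by (auto simp: min_def)
      next
        case False
        then have "1 / real (Suc k) \<le> 1 / real (Suc n)"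
          by (intro divide_left_mono) auto
        then show ?thesis
          using n by (auto simp: min_def)
      qed
    qed
  qed
qed

lemma limitin_iff_components:
  assumes s: "\<And>n. s n \<in> X" and L: "L \<in> X"
  shows "limitin mtopology s L sequentially \<longleftrightarrow> (\<forall>k. (\<lambda>n. \<delta> k (s n) L) \<longlonglongrightarrow> 0)"
proof -
  have "(\<lambda>n. sup_dist (s n) L) \<longlonglongrightarrow> 0 \<longleftrightarrow> (\<forall>k. (\<lambda>n. \<delta> k (s n) L) \<longlonglongrightarrow> 0)"
  proof (intro iffI allI)
    fix k
    assume lim: "(\<lambda>n. sup_dist (s n) L) \<longlonglongrightarrow> 0"
    show "(\<lambda>n. \<delta> k (s n) L) \<longlonglongrightarrow> 0"
    proof (rule metric_LIMSEQ_I)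
      fix e :: real
      assume "0 < e"
      then have "0 < min e (1 / real (Suc k))"
        by simp
      from order_tendstoD(2)[OF lim this]
      obtain N where N: "\<And>n. n \<ge> N \<Longrightarrow> sup_dist (s n) L < min e (1 / real (Suc k))"
        by (auto simp: eventually_sequentially)
      have "\<delta> k (s n) L < e" if "n \<ge> N" for n
        using component_less[OF s L N[OF that], of k] by simp
      then show "\<exists>N. \<forall>n\<ge>N. dist (\<delta> k (s n) L) 0 < e"
        using component_nonneg[OF s L] by auto
    qed
  next
    assume lim: "\<forall>k. (\<lambda>n. \<delta> k (s n) L) \<longlonglongrightarrow> 0"
    show "(\<lambda>n. sup_dist (s n) L) \<longlonglongrightarrow> 0"
    proof (rule metric_LIMSEQ_I)
      fix e :: real
      assume e: "0 < e"
      then obtain m where m: "\<And>x y. x \<in> X \<Longrightarrow> y \<in> X \<Longrightarrow> (\<And>k. k < m \<Longrightarrow> \<delta> k x y < e / 2)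
          \<Longrightarrow> sup_dist x y \<le> e / 2"
        using finitely_many_components_suffice[of "e / 2"] by auto
      have "\<forall>\<^sub>F n in sequentially. \<forall>k\<in>{..<m}. \<delta> k (s n) L < e / 2"
        using order_tendstoD(2)[OF lim[rule_format], of "e / 2"] e
        by (intro eventually_ball_finite ballI) (simp_all only: finite_lessThan half_gt_zero)
      then obtain N where N: "\<And>n k. n \<ge> N \<Longrightarrow> k < m \<Longrightarrow> \<delta> k (s n) L < e / 2"
        by (auto simp: eventually_sequentially)
      have "sup_dist (s n) L < e" if "n \<ge> N" for n
      proof -
        have "sup_dist (s n) L \<le> e / 2"
          using N[OF that] by (intro m s L)
        then show ?thesis
          using e by simp
      qed
      then show "\<exists>N. \<forall>n\<ge>N. dist (sup_dist (s n) L) 0 < e"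
        using sup_dist_nonneg by auto
    qed
  qed
  then show ?thesis
    using assms by (simp add: limitin_metric_dist_null)
qed

text \<open>In a metric space the limits of subsequences may be sought anywhere in the space, since limits of
  sequences from \<open>A\<close> lie in the closure of \<open>A\<close> anyway.\<close>

lemma relatively_compact_iff_subsequences:
  "relatively_compact_in mtopology A \<longleftrightarrow> A \<subseteq> X \<and>
    (\<forall>s::nat \<Rightarrow> 'c. range s \<subseteq> A \<longrightarrow>
      (\<exists>r L. strict_mono r \<and> L \<in> X \<and> (\<forall>k. (\<lambda>n. \<delta> k (s (r n)) L) \<longlonglongrightarrow> 0)))"
proof (cases "A \<subseteq> X")
  case True
  have "compactin mtopology (mtopology closure_of A) \<longleftrightarrow>
      (\<forall>T. T \<subseteq> A \<and> infinite T \<longrightarrow> X \<inter> mtopology derived_set_of T \<noteq> {})"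
    using True derived_set_of_subset_topspace[of mtopology]
    unfolding compact_closure_of_eq_Bolzano_Weierstrass topspace_mtopology
    by (auto simp: Int_absorb1)
  also have "\<dots> \<longleftrightarrow> (\<forall>s::nat \<Rightarrow> 'c. range s \<subseteq> A \<longrightarrow>
      (\<exists>L r. L \<in> X \<and> strict_mono r \<and> limitin mtopology (s \<circ> r) L sequentially))"
    using Bolzano_Weierstrass_property[OF True True] by simp
  also have "\<dots> \<longleftrightarrow> (\<forall>s::nat \<Rightarrow> 'c. range s \<subseteq> A \<longrightarrow>
      (\<exists>r L. strict_mono r \<and> L \<in> X \<and> (\<forall>k. (\<lambda>n. \<delta> k (s (r n)) L) \<longlonglongrightarrow> 0)))"
  proof (intro all_cong1 imp_cong refl)
    fix s :: "nat \<Rightarrow> 'c"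
    assume "range s \<subseteq> A"
    then have "limitin mtopology (s \<circ> r) L sequentially \<longleftrightarrow> (\<forall>k. (\<lambda>n. \<delta> k (s (r n)) L) \<longlonglongrightarrow> 0)"
      if "L \<in> X" for L and r :: "nat \<Rightarrow> nat"
      using limitin_iff_components[of "s \<circ> r" L] that True by (auto simp: image_subset_iff o_def)
    then show "(\<exists>L r. L \<in> X \<and> strict_mono r \<and> limitin mtopology (s \<circ> r) L sequentially) \<longleftrightarrow>
        (\<exists>r L. strict_mono r \<and> L \<in> X \<and> (\<forall>k. (\<lambda>n. \<delta> k (s (r n)) L) \<longlonglongrightarrow> 0))"
      by metis
  qed
  finally show ?thesis
    using True by (simp add: relatively_compact_in_def)
qed (simp add: relatively_compact_in_def)

text \<open>A ball of any dominated pseudometric contains a metric ball around each of its points.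
  Conversely a metric ball contains the intersection of finitely many pseudometric balls.\<close>

lemma generated_topology_eq_mtopology:
  assumes dominated: "\<And>q. q \<in> Q \<Longrightarrow> \<exists>k. \<forall>x\<in>X. \<forall>y\<in>X. \<rho> q x y \<le> \<delta> k x y"
    and member: "\<And>k. \<exists>q\<in>Q. \<forall>x\<in>X. \<forall>y\<in>X. \<rho> q x y = \<delta> k x y"
    and triangle_Q: "\<And>q x y z. q \<in> Q \<Longrightarrow> x \<in> X \<Longrightarrow> y \<in> X \<Longrightarrow> z \<in> X \<Longrightarrow>
      \<rho> q x z \<le> \<rho> q x y + \<rho> q y z"
  shows "topology_generated_by
      (insert X {{y \<in> X. \<rho> q x y < e} | x q e. x \<in> X \<and> q \<in> Q \<and> 0 < e}) = mtopology"
    (is "?T = _")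
proof (rule topology_eq[THEN iffD2], intro allI iffI)
  fix U
  assume "openin ?T U"
  then have "generate_topology_on
      (insert X {{y \<in> X. \<rho> q x y < e} | x q e. x \<in> X \<and> q \<in> Q \<and> 0 < e}) U"
    by (rule openin_topology_generated_by)
  then show "openin mtopology U"
  proof induction
    case (Basis U)
    show ?case
    proof (cases "U = X")
      case True
      then show ?thesis
        using openin_topspace[of mtopology] by simp
    next
      case False
      then obtain x q e where U: "U = {y \<in> X. \<rho> q x y < e}" and x: "x \<in> X" and q: "q \<in> Q"
        using Basis by auto
      obtain k where k: "\<And>x y. x \<in> X \<Longrightarrow> y \<in> X \<Longrightarrow> \<rho> q x y \<le> \<delta> k x y"
        using dominated[OF q] by blast
      show ?thesis
        unfolding openin_mtopology
      proof (intro conjI allI impI)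
        show "U \<subseteq> X"
          by (auto simp: U)
        fix y
        assume "y \<in> U"
        then have y: "y \<in> X" and less: "\<rho> q x y < e"
          by (auto simp: U)
        define d where "d = min (e - \<rho> q x y) (1 / real (Suc k))"
        have "0 < d"
          using less by (simp add: d_def)
        moreover have "mball y d \<subseteq> U"
        proof
          fix z
          assume "z \<in> mball y d"
          then have z: "z \<in> X" and "sup_dist y z < d"
            by auto
          then have "\<delta> k y z < d"
            using y by (intro component_less) (auto simp: d_def)
          then have "\<rho> q y z < e - \<rho> q x y"
            using k[OF y z] by (simp add: d_def)
          then show "z \<in> U"
            using triangle_Q[OF q x y z] z by (simp add: U)
        qed
        ultimately show "\<exists>r>0. mball y r \<subseteq> U"
          by blast
      qed
    qed
  qed auto
next
  fix U
  assume U: "openin mtopology U"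
  show "openin ?T U"
  proof (subst openin_subopen, intro ballI)
    fix x
    assume xU: "x \<in> U"
    with U obtain r where r: "0 < r" "mball x r \<subseteq> U" and x: "x \<in> X"
      unfolding openin_mtopology by blast
    obtain n where n: "\<And>y. y \<in> X \<Longrightarrow> (\<And>k. k < n \<Longrightarrow> \<delta> k x y < r / 2) \<Longrightarrow> sup_dist x y \<le> r / 2"
      using finitely_many_components_suffice[of "r / 2"] r(1) x by (metis half_gt_zero)
    define V where "V = X \<inter> (\<Inter>k\<in>{..<n}. {y \<in> X. \<delta> k x y < r / 2})"
    have X_open: "openin ?T X"
      by (rule topology_generated_by_Basis) simp
    have "openin ?T (\<Inter>(insert X ((\<lambda>k. {y \<in> X. \<delta> k x y < r / 2}) ` {..<n})))"
    proof (rule openin_Inter)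
      fix W
      assume "W \<in> insert X ((\<lambda>k. {y \<in> X. \<delta> k x y < r / 2}) ` {..<n})"
      then consider "W = X" | k where "W = {y \<in> X. \<delta> k x y < r / 2}"
        by blast
      then show "openin ?T W"
      proof cases
        case (2 k)
        obtain q where q: "q \<in> Q" "\<forall>x\<in>X. \<forall>y\<in>X. \<rho> q x y = \<delta> k x y"
          using member by blast
        then have "W = {y \<in> X. \<rho> q x y < r / 2}"
          using x 2 by auto
        with q(1) x r(1) show ?thesis
          by (intro topology_generated_by_Basis insertI2 CollectI exI[of _ x] exI[of _ q]
              exI[of _ "r / 2"]) auto
      qed (simp add: X_open)
    qed auto
    then have "openin ?T V"
      by (simp add: V_def)
    moreover have "x \<in> V"
      using x r(1) by (simp add: V_def self_zero)
    moreover have "V \<subseteq> U"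
    proof
      fix y
      assume y: "y \<in> V"
      then have "sup_dist x y \<le> r / 2"
        by (intro n) (auto simp: V_def)
      then have "y \<in> mball x r"
        using y x r(1) by (auto simp: V_def)
      then show "y \<in> U"
        using r(2) by blast
    qed
    ultimately show "\<exists>T. openin ?T T \<and> x \<in> T \<and> T \<subseteq> U"
      by blast
  qed
qed

end

text \<open>Relative compactness is a statement about subsequences, since countably many
  pseudometrics that separate points make the seminorm topology metrizable. It suffices that
  countably many members \<open>\<delta> k\<close> of the family dominate all the others.\<close>

lemma relatively_compact_in_seminorm_topology_iff:
  fixes X :: "('a \<Rightarrow> 'b::real_vector) set set" and \<delta> :: "nat \<Rightarrow> ('a \<Rightarrow> 'b) \<Rightarrow> real"
    and d :: "(('a \<Rightarrow> 'b) \<Rightarrow> real) \<Rightarrow> ('a \<Rightarrow> 'b) set \<Rightarrow> ('a \<Rightarrow> 'b) set \<Rightarrow> real"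
  assumes d: "\<And>q F G. d q F G = q (\<lambda>z. representative G z - representative F z)"
    and self: "\<And>q F. q \<in> Q \<Longrightarrow> F \<in> X \<Longrightarrow> d q F F = 0"
    and sym: "\<And>q F G. q \<in> Q \<Longrightarrow> F \<in> X \<Longrightarrow> G \<in> X \<Longrightarrow> d q F G = d q G F"
    and tri: "\<And>q F G H. q \<in> Q \<Longrightarrow> F \<in> X \<Longrightarrow> G \<in> X \<Longrightarrow> H \<in> X \<Longrightarrow> d q F H \<le> d q F G + d q G H"
    and \<delta>: "range \<delta> \<subseteq> Q"
    and dominated: "\<And>q. q \<in> Q \<Longrightarrow> \<exists>k. \<forall>F\<in>X. \<forall>G\<in>X. d q F G \<le> d (\<delta> k) F G"
    and sep: "\<And>F G. F \<in> X \<Longrightarrow> G \<in> X \<Longrightarrow> (\<And>k. d (\<delta> k) F G = 0) \<Longrightarrow> F = G"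
  shows "relatively_compact_in (seminorm_topology X Q) A \<longleftrightarrow> A \<subseteq> X \<and>
    (\<forall>s::nat \<Rightarrow> _. range s \<subseteq> A \<longrightarrow>
      (\<exists>r L. strict_mono r \<and> L \<in> X \<and> (\<forall>q\<in>Q. (\<lambda>n. d q L (s (r n))) \<longlonglongrightarrow> 0)))"
proof -
  have \<delta>Q: "\<delta> k \<in> Q" for k
    using \<delta> by blast
  interpret pseudometric_sequence X "\<lambda>k. d (\<delta> k)"
    by unfold_locales (fact self[OF \<delta>Q] sym[OF \<delta>Q] tri[OF \<delta>Q] sep)+
  have topology: "seminorm_topology X Q = mtopology"
    unfolding seminorm_topology_def d[symmetric]
  proof (rule generated_topology_eq_mtopology)
    show "\<exists>q\<in>Q. \<forall>F\<in>X. \<forall>G\<in>X. d q F G = d (\<delta> k) F G" for k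
      using \<delta>Q by blast
  qed (fact dominated tri)+
  have limits: "(\<forall>k. (\<lambda>n. d (\<delta> k) (s (r n)) L) \<longlonglongrightarrow> 0) \<longleftrightarrow> (\<forall>q\<in>Q. (\<lambda>n. d q L (s (r n))) \<longlonglongrightarrow> 0)"
    if "range s \<subseteq> A" "A \<subseteq> X" "L \<in> X" for s L and r :: "nat \<Rightarrow> nat"
  proof (intro iffI allI ballI)
    have s: "s n \<in> X" for n
      using that by blast
    fix q
    assume lim: "\<forall>k. (\<lambda>n. d (\<delta> k) (s (r n)) L) \<longlonglongrightarrow> 0" and q: "q \<in> Q"
    obtain k where k: "\<forall>F\<in>X. \<forall>G\<in>X. d q F G \<le> d (\<delta> k) F G"
      using dominated[OF q] by blast
    have le: "d q L (s (r n)) \<le> d (\<delta> k) (s (r n)) L" for n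
      using k s that(3) sym[OF q] by metis
    have ge: "0 \<le> d q L (s (r n))" for n
      using tri[OF q that(3) s that(3), of "r n"] sym[OF q s that(3), of "r n"] self[OF q that(3)]
      by linarith
    show "(\<lambda>n. d q L (s (r n))) \<longlonglongrightarrow> 0"
      by (rule tendsto_sandwich[OF _ _ tendsto_const lim[rule_format, of k]]) (auto simp: le ge)
  next
    have s: "s n \<in> X" for n
      using that by blast
    fix k
    assume "\<forall>q\<in>Q. (\<lambda>n. d q L (s (r n))) \<longlonglongrightarrow> 0"
    then have "(\<lambda>n. d (\<delta> k) L (s (r n))) \<longlonglongrightarrow> 0"
      using \<delta>Q by blast
    then show "(\<lambda>n. d (\<delta> k) (s (r n)) L) \<longlonglongrightarrow> 0"
      using sym[OF \<delta>Q s that(3)] by simp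
  qed
  show ?thesis
  proof (cases "A \<subseteq> X")
    case True
    have "(\<exists>r L. strict_mono r \<and> L \<in> X \<and> (\<forall>k. (\<lambda>n. d (\<delta> k) (s (r n)) L) \<longlonglongrightarrow> 0)) \<longleftrightarrow>
        (\<exists>r L. strict_mono r \<and> L \<in> X \<and> (\<forall>q\<in>Q. (\<lambda>n. d q L (s (r n))) \<longlonglongrightarrow> 0))"
      if "range s \<subseteq> A" for s :: "nat \<Rightarrow> _"
      using limits[OF that True] by (intro ex_cong1) blast
    then have "(\<forall>s::nat \<Rightarrow> _. range s \<subseteq> A \<longrightarrow>
          (\<exists>r L. strict_mono r \<and> L \<in> X \<and> (\<forall>k. (\<lambda>n. d (\<delta> k) (s (r n)) L) \<longlonglongrightarrow> 0))) \<longleftrightarrow>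
        (\<forall>s::nat \<Rightarrow> _. range s \<subseteq> A \<longrightarrow>
          (\<exists>r L. strict_mono r \<and> L \<in> X \<and> (\<forall>q\<in>Q. (\<lambda>n. d q L (s (r n))) \<longlonglongrightarrow> 0)))"
      by (intro all_cong1 imp_cong refl)
    then show ?thesis
      unfolding topology relatively_compact_iff_subsequences by (rule arg_cong)
  qed (simp add: topology relatively_compact_iff_subsequences)
qed

section \<open>The \<open>p\<close>-norm\<close>

definition p_integrable :: "real \<Rightarrow> 'a measure \<Rightarrow> ('a \<Rightarrow> 'b::euclidean_space) \<Rightarrow> bool"
  where "p_integrable p M u \<longleftrightarrow> u \<in> borel_measurable M \<and> integrable M (\<lambda>t. norm (u t) powr p)"

definition p_norm :: "real \<Rightarrow> 'a measure \<Rightarrow> ('a \<Rightarrow> 'b::euclidean_space) \<Rightarrow> real"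
  where "p_norm p M u = (\<integral>t. norm (u t) powr p \<partial>M) powr (1 / p)"

lemma Lp_seminorm_eq_p_norm: "Lp_seminorm p {a..b} u = p_norm p (lebesgue_on {a..b}) u"
  by (simp add: Lp_seminorm_def p_norm_def set_lebesgue_integral_def integral_restrict_space)

lemma Lp_loc_functions_iff:
  "u \<in> Lp_loc_functions p \<longleftrightarrow> (\<forall>a b. p_integrable p (lebesgue_on {a..b}) u)"
  by (simp add: Lp_loc_functions_def p_integrable_def)

lemma p_norm_nonneg: "0 \<le> p_norm p M u"
  by (simp add: p_norm_def)

lemma p_norm_powr:
  assumes "1 \<le> p"
  shows "p_norm p M u powr p = (\<integral>t. norm (u t) powr p \<partial>M)"
  using assms by (simp add: p_norm_def powr_powr integral_nonneg_AE)

lemma p_norm_le_iff: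
  assumes "1 \<le> p" "0 \<le> c"
  shows "p_norm p M u \<le> c \<longleftrightarrow> (\<integral>t. norm (u t) powr p \<partial>M) \<le> c powr p"
proof -
  have "p_norm p M u \<le> c \<longleftrightarrow> p_norm p M u powr p \<le> c powr p"
    using assms p_norm_nonneg[of p M u] powr_mono2[of p "p_norm p M u" c]
      powr_less_mono2[of p c "p_norm p M u"] by (auto simp: not_le[symmetric])
  then show ?thesis
    by (simp add: p_norm_powr assms)
qed

lemma p_norm_eq_0_iff:
  assumes "1 \<le> p" "p_integrable p M u"
  shows "p_norm p M u = 0 \<longleftrightarrow> (AE t in M. u t = 0)"
  using assms by (simp add: p_norm_def p_integrable_def integral_nonneg_eq_0_iff_AE)

lemma p_norm_minus_commute: "p_norm p M (\<lambda>t. u t - v t) = p_norm p M (\<lambda>t. v t - u t)"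
  by (simp add: p_norm_def norm_minus_commute)

lemma p_norm_mono:
  assumes "1 \<le> p" "p_integrable p M v" "AE t in M. norm (u t) \<le> norm (v t)"
  shows "p_norm p M u \<le> p_norm p M v"
proof -
  have "AE t in M. norm (u t) powr p \<le> norm (v t) powr p"
    using assms(3) by eventually_elim (use assms(1) in \<open>simp add: powr_mono2\<close>)
  then have "(\<integral>t. norm (u t) powr p \<partial>M) \<le> (\<integral>t. norm (v t) powr p \<partial>M)"
    using assms(2) by (intro integral_mono_AE') (auto simp: p_integrable_def)
  then show ?thesis
    using assms(1) unfolding p_norm_def by (intro powr_mono2) (auto simp: integral_nonneg_AE)
qed

lemma p_norm_cong_AE:
  assumes "1 \<le> p" "p_integrable p M u" "p_integrable p M v" "AE t in M. norm (u t) = norm (v t)"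
  shows "p_norm p M u = p_norm p M v"
  using assms by (intro antisym p_norm_mono) auto

lemma p_integrable_bound:
  assumes "1 \<le> p" "p_integrable p M v" "u \<in> borel_measurable M"
    and "AE t in M. norm (u t) \<le> norm (v t)"
  shows "p_integrable p M u"
proof -
  have "AE t in M. norm (norm (u t) powr p) \<le> norm (norm (v t) powr p)"
    using assms(4) by eventually_elim (use assms(1) in \<open>simp add: powr_mono2\<close>)
  then show ?thesis
    using assms(2,3) unfolding p_integrable_def
    by (auto intro: Bochner_Integration.integrable_bound)
qed

lemma powr_add_le:
  fixes a b p :: real
  assumes "0 \<le> p" "0 \<le> a" "0 \<le> b"
  shows "(a + b) powr p \<le> 2 powr p * (a powr p + b powr p)"
proof -
  have "(a + b) powr p \<le> (2 * max a b) powr p"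
    using assms by (intro powr_mono2) auto
  also have "\<dots> = 2 powr p * max a b powr p"
    using assms by (simp add: powr_mult)
  also have "\<dots> \<le> 2 powr p * (a powr p + b powr p)"
    by (intro mult_left_mono) (auto simp: max_def)
  finally show ?thesis .
qed

lemma p_integrable_add:
  assumes "1 \<le> p" "p_integrable p M u" "p_integrable p M v"
  shows "p_integrable p M (\<lambda>t. u t + v t)"
proof -
  have [measurable]: "u \<in> borel_measurable M" "v \<in> borel_measurable M"
    using assms by (auto simp: p_integrable_def)
  have "norm (u t + v t) powr p \<le> 2 powr p * (norm (u t) powr p + norm (v t) powr p)" for t
  proof -
    have "norm (u t + v t) powr p \<le> (norm (u t) + norm (v t)) powr p"
      using assms(1) by (intro powr_mono2) (auto simp: norm_triangle_ineq)
    also have "\<dots> \<le> 2 powr p * (norm (u t) powr p + norm (v t) powr p)"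
      using assms(1) by (intro powr_add_le) auto
    finally show ?thesis .
  qed
  moreover have "integrable M (\<lambda>t. 2 powr p * (norm (u t) powr p + norm (v t) powr p))"
    using assms by (auto simp: p_integrable_def)
  ultimately have "integrable M (\<lambda>t. norm (u t + v t) powr p)"
    by (elim Bochner_Integration.integrable_bound[rotated 2, OF AE_I2, rotated]) auto
  then show ?thesis
    by (simp add: p_integrable_def)
qed

lemma p_integrable_cmult:
  fixes u :: "'a \<Rightarrow> real"
  assumes "p_integrable p M u"
  shows "p_integrable p M (\<lambda>t. c * u t)"
  using assms by (auto simp: p_integrable_def abs_mult powr_mult)

lemma p_integrable_norm: "p_integrable p M u \<Longrightarrow> p_integrable p M (\<lambda>t. norm (u t))"
  by (auto simp: p_integrable_def)

lemma p_integrable_diff: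
  assumes "1 \<le> p" "p_integrable p M u" "p_integrable p M v"
  shows "p_integrable p M (\<lambda>t. u t - v t)"
proof -
  have "p_integrable p M (\<lambda>t. - v t)"
    using assms by (simp add: p_integrable_def)
  from p_integrable_add[OF assms(1,2) this] show ?thesis
    by simp
qed

lemma powr_convex_combination:
  fixes x y s t p :: real
  assumes p: "1 \<le> p" and nonneg: "0 \<le> x" "0 \<le> y" "0 \<le> s" "0 \<le> t" and sum: "s + t = 1"
  shows "(s * x + t * y) powr p \<le> s * x powr p + t * y powr p"
proof -
  have scale: "(c * z) powr p \<le> c * z powr p" if "0 \<le> c" "c \<le> 1" "0 \<le> z" for c z :: real
  proof -
    have "c powr p \<le> c"
      using that p powr_mono'[of 1 p c] by (cases "c = 0") auto
    then show ?thesis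
      using that by (simp add: powr_mult mult_right_mono)
  qed
  consider "x = 0" | "y = 0" | "0 < x" "0 < y"
    using nonneg by linarith
  then show ?thesis
  proof cases
    case 1
    then show ?thesis
      using scale[of t y] nonneg sum by simp
  next
    case 2
    then show ?thesis
      using scale[of s x] nonneg sum by simp
  next
    case 3
    have "s = 1 - t" "t \<le> 1"
      using nonneg sum by auto
    then show ?thesis
      using convex_onD[OF powr_convex[OF p], of t x y] 3 nonneg by simp
  qed
qed

text \<open>Minkowski's inequality. For \<open>a > p_norm p M u\<close> and \<open>b > p_norm p M v\<close>, integrating the convexity
  inequality for \<open>x \<mapsto> x powr p\<close> at the points \<open>norm u / a\<close> and \<open>norm v / b\<close> with weights
  proportional to \<open>a\<close> and \<open>b\<close> bounds the norm of the sum by \<open>a + b\<close>. Working with strict upper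
  bounds avoids dividing by a vanishing norm.\<close>

lemma p_norm_add_le:
  assumes p: "1 \<le> p" and u: "p_integrable p M u" and v: "p_integrable p M v"
  shows "p_norm p M (\<lambda>t. u t + v t) \<le> p_norm p M u + p_norm p M v"
proof (rule field_le_epsilon)
  fix e :: real
  assume e: "0 < e"
  define a b where "a = p_norm p M u + e / 2" and "b = p_norm p M v + e / 2"
  have a: "0 < a" and b: "0 < b"
    using e p_norm_nonneg[of p M u] p_norm_nonneg[of p M v] by (simp_all add: a_def b_def)
  have ab: "a + b \<noteq> 0"
    using a b by simp
  then have weights: "a / (a + b) + b / (a + b) = 1"
    by (simp add: add_divide_distrib[symmetric])
  define A B where "A = (\<integral>t. norm (u t) powr p \<partial>M)" and "B = (\<integral>t. norm (v t) powr p \<partial>M)"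
  have A: "A \<le> a powr p" and B: "B \<le> b powr p"
    using p_norm_le_iff[OF p, of a M u] p_norm_le_iff[OF p, of b M v] a b e
    by (simp_all add: A_def B_def a_def b_def)
  have iu: "integrable M (\<lambda>t. norm (u t) powr p)" and iv: "integrable M (\<lambda>t. norm (v t) powr p)"
    using u v by (auto simp: p_integrable_def)
  define su sv where "su = (a + b) powr p * (a / (a + b)) / a powr p"
    and "sv = (a + b) powr p * (b / (a + b)) / b powr p"
  have pointwise: "norm (u t + v t) powr p \<le> su * norm (u t) powr p + sv * norm (v t) powr p" for t
  proof -
    have "norm (u t + v t) powr p \<le> (norm (u t) + norm (v t)) powr p"
      using p by (intro powr_mono2) (auto simp: norm_triangle_ineq)
    also have "\<dots> = ((a + b) * (a / (a + b) * (norm (u t) / a) + b / (a + b) * (norm (v t) / b))) powr p"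
      using a b ab by (simp only: distrib_left) simp
    also have "\<dots> = (a + b) powr p * (a / (a + b) * (norm (u t) / a) + b / (a + b) * (norm (v t) / b)) powr p"
      using a b by (intro powr_mult)
    also have "\<dots> \<le> (a + b) powr p * (a / (a + b) * (norm (u t) / a) powr p + b / (a + b) * (norm (v t) / b) powr p)"
      using a b by (intro mult_left_mono powr_convex_combination p weights) auto
    also have "\<dots> = su * norm (u t) powr p + sv * norm (v t) powr p"
      using a b by (simp add: su_def sv_def powr_divide algebra_simps)
    finally show ?thesis .
  qed
  have "(\<integral>t. norm (u t + v t) powr p \<partial>M) \<le> (\<integral>t. su * norm (u t) powr p + sv * norm (v t) powr p \<partial>M)"
    using p_integrable_add[OF p u v] iu iv pointwise
    by (intro integral_mono) (auto simp: p_integrable_def)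
  also have "\<dots> = su * A + sv * B"
    using iu iv by (simp add: A_def B_def)
  also have "\<dots> \<le> su * a powr p + sv * b powr p"
    using A B a b by (intro add_mono mult_left_mono) (auto simp: su_def sv_def)
  also have "\<dots> = (a + b) powr p * (a / (a + b) + b / (a + b))"
    using a b by (simp add: su_def sv_def distrib_left)
  also note weights
  finally have "p_norm p M (\<lambda>t. u t + v t) \<le> a + b"
    using a b by (subst p_norm_le_iff[OF p]) auto
  then show "p_norm p M (\<lambda>t. u t + v t) \<le> p_norm p M u + p_norm p M v + e"
    by (simp add: a_def b_def)
qed

lemma p_norm_diff_triangle:
  assumes p: "1 \<le> p"
    and "p_integrable p M u" "p_integrable p M v" "p_integrable p M w"
  shows "p_norm p M (\<lambda>t. u t - w t) \<le> p_norm p M (\<lambda>t. u t - v t) + p_norm p M (\<lambda>t. v t - w t)"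
  using p_norm_add_le[OF p, of M "\<lambda>t. u t - v t" "\<lambda>t. v t - w t"] assms
  by (simp add: p_integrable_diff)

lemma tendsto_0_squeeze:
  fixes a b :: "nat \<Rightarrow> real"
  assumes "\<And>n. 0 \<le> a n" "\<And>n. a n \<le> b n" "b \<longlonglongrightarrow> 0"
  shows "a \<longlonglongrightarrow> 0"
  by (rule Lim_null_comparison[OF _ assms(3)]) (simp add: assms(1,2))

lemma p_norm_tendsto_0_imp_AE_subseq:
  assumes p: "1 \<le> p" and u: "\<And>n. p_integrable p M (u n)"
    and lim: "(\<lambda>n. p_norm p M (u n)) \<longlonglongrightarrow> 0"
  obtains r :: "nat \<Rightarrow> nat" where "strict_mono r" "AE t in M. (\<lambda>n. u (r n) t) \<longlonglongrightarrow> 0"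
proof -
  have "(\<lambda>n. p_norm p M (u n) powr p) \<longlonglongrightarrow> 0 powr p"
    using p by (intro tendsto_powr2[OF lim]) (auto simp: p_norm_nonneg)
  then have "(\<lambda>n. \<integral>t. norm (norm (u n t) powr p) \<partial>M) \<longlonglongrightarrow> 0"
    using p by (simp add: p_norm_powr)
  then obtain r :: "nat \<Rightarrow> nat" where r: "strict_mono r"
      and AE: "AE t in M. (\<lambda>n. norm (u (r n) t) powr p) \<longlonglongrightarrow> 0"
    using tendsto_L1_AE_subseq[of M "\<lambda>n t. norm (u n t) powr p"] u
    unfolding p_integrable_def by blast
  have "AE t in M. (\<lambda>n. u (r n) t) \<longlonglongrightarrow> 0"
    using AE
  proof eventually_elim
    case (elim t)
    have "(\<lambda>n. (norm (u (r n) t) powr p) powr (1 / p)) \<longlonglongrightarrow> 0 powr (1 / p)"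
      using p by (intro tendsto_powr2[OF elim]) auto
    then show ?case
      using p by (simp add: powr_powr tendsto_norm_zero_iff)
  qed
  with r show ?thesis
    using that by blast
qed

section \<open>Functions that are locally Lipschitz in space\<close>

lemma AE_lebesgue_on: "(AE t in lebesgue. P t) \<Longrightarrow> AE t in lebesgue_on {a..b::real}. P t"
  by (simp add: AE_restrict_space_iff) (auto elim: eventually_mono)

lemma Lp_loc_add:
  "1 \<le> p \<Longrightarrow> u \<in> Lp_loc_functions p \<Longrightarrow> v \<in> Lp_loc_functions p \<Longrightarrow>
    (\<lambda>t. u t + v t) \<in> Lp_loc_functions p"
  by (simp add: Lp_loc_functions_iff p_integrable_add)

lemma LC_bound:
  assumes "f \<in> LC_functions p" "compact K"
  obtains m where "m \<in> Lp_loc_functions p" "AE t in lebesgue. \<forall>x\<in>K. norm (f (t, x)) \<le> m t"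
  using assms unfolding LC_functions_def by blast

lemma LC_lipschitz:
  assumes "f \<in> LC_functions p" "compact K"
  obtains l where "l \<in> Lp_loc_functions p"
    "AE t in lebesgue. \<forall>x\<in>K. \<forall>y\<in>K. norm (f (t, x) - f (t, y)) \<le> l t * norm (x - y)"
  using assms unfolding LC_functions_def by blast

lemma LC_borel_measurable: "f \<in> LC_functions p \<Longrightarrow> f \<in> borel_measurable borel"
  by (simp add: LC_functions_def)

lemma LC_diff:
  fixes f g :: "real \<times> (real ^ 'n) \<Rightarrow> real ^ 'm"
  assumes p: "1 \<le> p" and f: "f \<in> LC_functions p" and g: "g \<in> LC_functions p"
  shows "(\<lambda>z. f z - g z) \<in> LC_functions p"
proof -
  have [measurable]: "f \<in> borel_measurable borel" "g \<in> borel_measurable borel"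
    using f g by (simp_all add: LC_borel_measurable)
  have bound: "\<exists>m\<in>Lp_loc_functions p. AE t in lebesgue. \<forall>x\<in>K. norm (f (t, x) - g (t, x)) \<le> m t"
    if K: "compact K" for K
  proof -
    from LC_bound[OF f K] obtain m where m: "m \<in> Lp_loc_functions p"
      "AE t in lebesgue. \<forall>x\<in>K. norm (f (t, x)) \<le> m t" .
    from LC_bound[OF g K] obtain m' where m': "m' \<in> Lp_loc_functions p"
      "AE t in lebesgue. \<forall>x\<in>K. norm (g (t, x)) \<le> m' t" .
    have "AE t in lebesgue. \<forall>x\<in>K. norm (f (t, x) - g (t, x)) \<le> m t + m' t"
      using m(2) m'(2)
      by eventually_elim (auto intro: order_trans[OF norm_triangle_ineq4 add_mono])
    with Lp_loc_add[OF p m(1) m'(1)] show ?thesis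
      by (intro bexI[of _ "\<lambda>t. m t + m' t"])
  qed
  have lipschitz: "\<exists>l\<in>Lp_loc_functions p. AE t in lebesgue. \<forall>x\<in>K. \<forall>y\<in>K.
      norm (f (t, x) - g (t, x) - (f (t, y) - g (t, y))) \<le> l t * norm (x - y)"
    if K: "compact K" for K
  proof -
    from LC_lipschitz[OF f K] obtain l where l: "l \<in> Lp_loc_functions p"
      "AE t in lebesgue. \<forall>x\<in>K. \<forall>y\<in>K. norm (f (t, x) - f (t, y)) \<le> l t * norm (x - y)" .
    from LC_lipschitz[OF g K] obtain l' where l': "l' \<in> Lp_loc_functions p"
      "AE t in lebesgue. \<forall>x\<in>K. \<forall>y\<in>K. norm (g (t, x) - g (t, y)) \<le> l' t * norm (x - y)" .
    have split: "norm (a - c - (b - d)) \<le> norm (a - b) + norm (c - d)" for a b c d :: "real ^ 'm"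
      using norm_triangle_ineq4[of "a - b" "c - d"] by (simp add: algebra_simps)
    have "AE t in lebesgue. \<forall>x\<in>K. \<forall>y\<in>K.
        norm (f (t, x) - g (t, x) - (f (t, y) - g (t, y))) \<le> (l t + l' t) * norm (x - y)"
      using l(2) l'(2)
    proof eventually_elim
      case (elim t)
      show ?case
      proof (intro ballI)
        fix x y
        assume "x \<in> K" "y \<in> K"
        then have "norm (f (t, x) - f (t, y)) + norm (g (t, x) - g (t, y))
            \<le> l t * norm (x - y) + l' t * norm (x - y)"
          using elim by (intro add_mono) auto
        then show "norm (f (t, x) - g (t, x) - (f (t, y) - g (t, y))) \<le> (l t + l' t) * norm (x - y)"
          using split[of "f (t, x)" "g (t, x)" "f (t, y)" "g (t, y)"] by (simp add: distrib_right)
      qed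
    qed
    with Lp_loc_add[OF p l(1) l'(1)] show ?thesis
      by (intro bexI[of _ "\<lambda>t. l t + l' t"])
  qed
  show ?thesis
    using bound lipschitz unfolding LC_functions_def by simp
qed

lemma LC_curve_measurable:
  fixes f :: "real \<times> (real ^ 'n) \<Rightarrow> real ^ 'm"
  assumes "f \<in> LC_functions p" "continuous_on {a..b} x"
  shows "(\<lambda>t. f (t, x t)) \<in> borel_measurable (lebesgue_on {a..b})"
proof -
  have "x \<in> borel_measurable (lebesgue_on {a..b})"
    using assms(2) by (intro continuous_imp_measurable_on_sets_lebesgue) auto
  moreover have "(\<lambda>t. t) \<in> borel_measurable (lebesgue_on {a..b})"
    by (intro continuous_imp_measurable_on_sets_lebesgue) auto
  ultimately have "(\<lambda>t. (t, x t)) \<in> borel_measurable (lebesgue_on {a..b})"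
    by (intro borel_measurable_Pair)
  then show ?thesis
    using LC_borel_measurable[OF assms(1)] by (rule measurable_compose)
qed

text \<open>Since one \<open>p\<close>-integrable function dominates \<open>f\<close> on the whole ball, every curve in a fixed ball yields a
  \<open>p\<close>-integrable function of time, and the bound on its norm is uniform over these curves. This makes the
  suprema over curves below suprema of bounded sets.\<close>

lemma LC_curve_bound:
  fixes f :: "real \<times> (real ^ 'n) \<Rightarrow> real ^ 'm"
  assumes p: "1 \<le> p" and f: "f \<in> LC_functions p"
  obtains c where "\<And>x. x \<in> continuous_curves {a..b} j \<Longrightarrow>
    p_integrable p (lebesgue_on {a..b}) (\<lambda>t. f (t, x t)) \<and>
    p_norm p (lebesgue_on {a..b}) (\<lambda>t. f (t, x t)) \<le> c"
proof -
  from LC_bound[OF f compact_cball] obtain m where m: "m \<in> Lp_loc_functions p"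
    "AE t in lebesgue. \<forall>x\<in>cball 0 (real j). norm (f (t, x)) \<le> m t" .
  then have m_int: "p_integrable p (lebesgue_on {a..b}) m"
    by (simp add: Lp_loc_functions_iff)
  show ?thesis
  proof (rule that[of "p_norm p (lebesgue_on {a..b}) m"])
    fix x :: "real \<Rightarrow> real ^ 'n"
    assume x: "x \<in> continuous_curves {a..b} j"
    have "AE t in lebesgue_on {a..b}. t \<in> {a..b}"
      by (rule AE_I2) (simp add: space_restrict_space)
    with AE_lebesgue_on[OF m(2)]
    have le: "AE t in lebesgue_on {a..b}. norm (f (t, x t)) \<le> norm (m t)"
    proof eventually_elim
      case (elim t)
      then have "x t \<in> cball 0 (real j)"
        using x unfolding continuous_curves_def by blast
      then have "norm (f (t, x t)) \<le> m t"
        using elim(1) by blast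
      then show ?case
        by simp
    qed
    have "p_integrable p (lebesgue_on {a..b}) (\<lambda>t. f (t, x t))"
      using x f by (intro p_integrable_bound[OF p m_int _ le] LC_curve_measurable)
        (auto simp: continuous_curves_def)
    then show "p_integrable p (lebesgue_on {a..b}) (\<lambda>t. f (t, x t)) \<and>
        p_norm p (lebesgue_on {a..b}) (\<lambda>t. f (t, x t)) \<le> p_norm p (lebesgue_on {a..b}) m"
      using p_norm_mono[OF p m_int le] by blast
  qed
qed

lemma LC_curve_p_integrable:
  fixes f :: "real \<times> (real ^ 'n) \<Rightarrow> real ^ 'm"
  assumes "1 \<le> p" "f \<in> LC_functions p" "x \<in> continuous_curves {a..b} j"
  shows "p_integrable p (lebesgue_on {a..b}) (\<lambda>t. f (t, x t))"
  using LC_curve_bound[OF assms(1,2), of a b j] assms(3) by metis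

lemma constant_curve: "norm x \<le> real j \<Longrightarrow> (\<lambda>_. x) \<in> continuous_curves I j"
  by (auto simp: continuous_curves_def)

lemma LC_slice_in_Lp_loc:
  fixes f :: "real \<times> (real ^ 'n) \<Rightarrow> real ^ 'm"
  assumes "1 \<le> p" "f \<in> LC_functions p"
  shows "(\<lambda>t. f (t, x)) \<in> Lp_loc_functions p"
proof -
  obtain j where "norm x \<le> real j"
    using real_arch_simple by blast
  then show ?thesis
    using LC_curve_p_integrable[OF assms constant_curve] by (simp add: Lp_loc_functions_iff)
qed

lemma curve_p_norm_le_curve_seminorm:
  fixes f :: "real \<times> (real ^ 'n) \<Rightarrow> real ^ 'm"
  assumes p: "1 \<le> p" and f: "f \<in> LC_functions p"
    and C: "C \<subseteq> continuous_curves {a..b} j" and x: "x \<in> C"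
  shows "p_norm p (lebesgue_on {a..b}) (\<lambda>t. f (t, x t)) \<le> curve_seminorm p {a..b} C f"
proof -
  obtain c where "\<And>x. x \<in> continuous_curves {a..b} j \<Longrightarrow>
      p_norm p (lebesgue_on {a..b}) (\<lambda>t. f (t, x t)) \<le> c"
    using LC_curve_bound[OF p f] by metis
  then have "bdd_above ((\<lambda>x. Lp_seminorm p {a..b} (\<lambda>t. f (t, x t))) ` C)"
    using C by (intro bdd_aboveI[of _ c]) (auto simp: Lp_seminorm_eq_p_norm)
  from cSUP_upper[OF x this] show ?thesis
    by (simp add: curve_seminorm_def Lp_seminorm_eq_p_norm)
qed

lemma curve_seminorm_le:
  assumes "C \<noteq> {}" "\<And>x. x \<in> C \<Longrightarrow> p_norm p (lebesgue_on {a..b}) (\<lambda>t. f (t, x t)) \<le> c"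
  shows "curve_seminorm p {a..b} C f \<le> c"
  using assms unfolding curve_seminorm_def Lp_seminorm_eq_p_norm by (intro cSUP_least)

lemma curve_seminorm_nonneg:
  fixes f :: "real \<times> (real ^ 'n) \<Rightarrow> real ^ 'm"
  assumes "1 \<le> p" "f \<in> LC_functions p" "C \<subseteq> continuous_curves {a..b} j" "C \<noteq> {}"
  shows "0 \<le> curve_seminorm p {a..b} C f"
proof -
  obtain x where "x \<in> C"
    using assms(4) by blast
  then show ?thesis
    using curve_p_norm_le_curve_seminorm[OF assms(1-3), of x] p_norm_nonneg order_trans by blast
qed

lemma curve_seminorm_triangle:
  fixes f g h :: "real \<times> (real ^ 'n) \<Rightarrow> real ^ 'm"
  assumes p: "1 \<le> p" and f: "f \<in> LC_functions p" and g: "g \<in> LC_functions p"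
    and h: "h \<in> LC_functions p" and C: "C \<subseteq> continuous_curves {a..b} j" "C \<noteq> {}"
  shows "curve_seminorm p {a..b} C (\<lambda>z. f z - h z)
    \<le> curve_seminorm p {a..b} C (\<lambda>z. f z - g z) + curve_seminorm p {a..b} C (\<lambda>z. g z - h z)"
proof (rule curve_seminorm_le[OF C(2)])
  fix x
  assume x: "x \<in> C"
  then have x': "x \<in> continuous_curves {a..b} j"
    using C(1) by blast
  show "p_norm p (lebesgue_on {a..b}) (\<lambda>t. f (t, x t) - h (t, x t))
    \<le> curve_seminorm p {a..b} C (\<lambda>z. f z - g z) + curve_seminorm p {a..b} C (\<lambda>z. g z - h z)"
    by (rule order_trans[OF p_norm_diff_triangle add_mono[OF
          curve_p_norm_le_curve_seminorm curve_p_norm_le_curve_seminorm]])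
      (fact p LC_diff[OF p f g] LC_diff[OF p g h] C x LC_curve_p_integrable[OF p _ x', OF f]
          LC_curve_p_integrable[OF p _ x', OF g] LC_curve_p_integrable[OF p _ x', OF h])+
qed

text \<open>The exceptional null set of times in the Lipschitz condition depends on the compact set, so only
  countably many balls are used.\<close>

lemma LC_AE_continuous:
  fixes f :: "real \<times> (real ^ 'n) \<Rightarrow> real ^ 'm"
  assumes f: "f \<in> LC_functions p"
  shows "AE t in lebesgue. continuous_on UNIV (\<lambda>x. f (t, x))"
proof -
  have "AE t in lebesgue. \<exists>c. \<forall>x\<in>cball 0 (real j). \<forall>y\<in>cball 0 (real j).
      norm (f (t, x) - f (t, y)) \<le> c * norm (x - y)" for j
    by (rule LC_lipschitz[OF f compact_cball[of 0 "real j"]]) (auto elim: eventually_mono)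
  then have "AE t in lebesgue. \<forall>j. \<exists>c. \<forall>x\<in>cball 0 (real j). \<forall>y\<in>cball 0 (real j).
      norm (f (t, x) - f (t, y)) \<le> c * norm (x - y)"
    unfolding AE_all_countable by blast
  then show ?thesis
  proof eventually_elim
    case (elim t)
    show ?case
      unfolding continuous_on_eq_continuous_at[OF open_UNIV]
    proof
      fix x :: "real ^ 'n"
      obtain j where j: "norm x < real j"
        using reals_Archimedean2 by blast
      obtain c where c: "\<forall>x\<in>cball 0 (real j). \<forall>y\<in>cball 0 (real j).
          norm (f (t, x) - f (t, y)) \<le> c * norm (x - y)"
        using elim by blast
      have "\<bar>c\<bar>-lipschitz_on (ball 0 (real j)) (\<lambda>x. f (t, x))"
      proof (rule lipschitz_onI)
        fix x y :: "real ^ 'n"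
        assume "x \<in> ball 0 (real j)" "y \<in> ball 0 (real j)"
        then have "norm (f (t, x) - f (t, y)) \<le> c * norm (x - y)"
          using c by auto
        also have "\<dots> \<le> \<bar>c\<bar> * norm (x - y)"
          by (intro mult_right_mono) auto
        finally show "dist (f (t, x)) (f (t, y)) \<le> \<bar>c\<bar> * dist x y"
          by (simp add: dist_norm)
      qed simp
      then have "continuous_on (ball 0 (real j)) (\<lambda>x. f (t, x))"
        by (rule lipschitz_on_continuous_on)
      moreover have "x \<in> ball 0 (real j)"
        using j by simp
      ultimately show "isCont (\<lambda>x. f (t, x)) x"
        unfolding continuous_on_eq_continuous_at[OF open_ball] by blast
    qed
  qed
qed

lemma continuous_eq_on_dense:
  fixes f g :: "'a::topological_space \<Rightarrow> 'b::t2_space"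
  assumes "continuous_on UNIV f" "continuous_on UNIV g" "closure D = UNIV"
    and "\<And>x. x \<in> D \<Longrightarrow> f x = g x"
  shows "f x = g x"
proof -
  have "closed {x. f x = g x}"
    using assms(1,2) by (rule closed_Collect_eq)
  then have "closure D \<subseteq> {x. f x = g x}"
    using assms(4) by (intro closure_minimal) auto
  then show ?thesis
    using assms(3) by auto
qed

text \<open>The values on the lines \<open>x = const\<close> through a countable dense set determine a function almost
  everywhere: for almost every time both vertical sections are continuous and agree on the dense set,
  hence agree everywhere, and Tonelli's theorem applies.\<close>

lemma LC_AE_eq_if_dense:
  fixes f g :: "real \<times> (real ^ 'n) \<Rightarrow> real ^ 'm"
  assumes f: "f \<in> LC_functions p" and g: "g \<in> LC_functions p"
    and D: "countable D" "closure D = UNIV"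
    and eq: "\<And>x. x \<in> D \<Longrightarrow> AE t in lebesgue. f (t, x) = g (t, x)"
  shows "AE z in lebesgue. f z = g z"
proof -
  have [measurable]: "f \<in> borel_measurable borel" "g \<in> borel_measurable borel"
    using f g by (simp_all add: LC_borel_measurable)
  have "AE t in lebesgue. \<forall>x\<in>D. f (t, x) = g (t, x)"
    using D(1) eq by (simp add: AE_ball_countable)
  with LC_AE_continuous[OF f] LC_AE_continuous[OF g]
  have "AE t in lebesgue. \<forall>x. f (t, x) = g (t, x)"
    by eventually_elim (use continuous_eq_on_dense D(2) in blast)
  then have "AE t in lborel. AE x in lborel. f (t, x) = g (t, x)"
    by (simp add: AE_completion_iff) (auto elim: eventually_mono)
  moreover have "{z \<in> space (lborel \<Otimes>\<^sub>M lborel). f z = g z} \<in> sets (lborel \<Otimes>\<^sub>M lborel)"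
    unfolding lborel_prod by simp
  ultimately have "AE z in lborel \<Otimes>\<^sub>M lborel. f z = g z"
    by (intro lborel_pair.AE_pair_measure)
  then show ?thesis
    unfolding lborel_prod AE_completion_iff .
qed

text \<open>Fubini's theorem only gives equality for almost every \<open>x\<close>, for almost every \<open>t\<close>. Where
  both vertical sections are continuous, they differ on an open set, and an open null set is empty.
  Up to null sets, the slices of a class therefore do not depend on its representative.\<close>

lemma LC_AE_eq_slices:
  fixes f g :: "real \<times> (real ^ 'n) \<Rightarrow> real ^ 'm"
  assumes f: "f \<in> LC_functions p" and g: "g \<in> LC_functions p"
    and eq: "AE z in lebesgue. f z = g z"
  shows "AE t in lebesgue. \<forall>x. f (t, x) = g (t, x)"
proof -
  have "AE z in lborel \<Otimes>\<^sub>M lborel. f z = g z"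
    using eq unfolding lborel_prod AE_completion_iff .
  then have "AE t in lborel. AE x in lborel. f (t, x) = g (t, x)"
    by (rule lborel_pair.AE_pair)
  then have "AE t in lebesgue. AE x in lebesgue. f (t, x) = g (t, x)"
    by (simp add: AE_completion_iff)
  with LC_AE_continuous[OF f] LC_AE_continuous[OF g] show ?thesis
  proof eventually_elim
    case (elim t)
    obtain N where N: "negligible N" "{x. f (t, x) \<noteq> g (t, x)} \<subseteq> N"
      using elim(3) unfolding eventually_ae_filter_negligible by blast
    then have "negligible {x. f (t, x) \<noteq> g (t, x)}"
      using negligible_subset by blast
    moreover have "open {x. f (t, x) \<noteq> g (t, x)}"
      using elim(1,2) by (rule open_Collect_neq)
    ultimately have "{x. f (t, x) \<noteq> g (t, x)} = {}"
      using open_not_negligible by blast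
    then show ?case
      by blast
  qed
qed

section \<open>Relative compactness in terms of subsequences\<close>

lemma quotient_representative:
  assumes r: "equiv A r" and F: "F \<in> A // r"
  shows "representative F \<in> A" "F = r `` {representative F}"
proof -
  obtain f where f: "f \<in> A" "F = r `` {f}"
    using F by (auto elim: quotientE)
  then have "f \<in> F"
    using r equiv_class_self by fast
  then have "representative F \<in> F"
    unfolding representative_def by (rule someI)
  then have rel: "(f, representative F) \<in> r"
    using f by simp
  then show "representative F \<in> A"
    using r f(1) by (auto simp: equiv_def refl_on_def)
  show "F = r `` {representative F}"
    using equiv_class_eq[OF r rel] f(2) by simp
qed

lemma representative_of_class:
  assumes r: "equiv A r" and f: "f \<in> A"
  shows "(f, representative (r `` {f})) \<in> r"
proof -
  have "f \<in> r `` {f}"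
    using r f equiv_class_self by fast
  then have "representative (r `` {f}) \<in> r `` {f}"
    unfolding representative_def by (rule someI)
  then show ?thesis
    by simp
qed

lemma equiv_LC_rel: "equiv (LC_functions p) (LC_rel p)"
proof (rule equivI)
  show "trans (LC_rel p)"
  proof (rule transI)
    fix f g h
    assume "(f, g) \<in> LC_rel p" "(g, h) \<in> LC_rel p"
    then have fh: "f \<in> LC_functions p" "h \<in> LC_functions p"
      and eq: "AE z in lebesgue. f z = g z" "AE z in lebesgue. g z = h z"
      by (auto simp: LC_rel_def)
    from eq have "AE z in lebesgue. f z = h z"
      by eventually_elim simp
    with fh show "(f, h) \<in> LC_rel p"
      by (simp add: LC_rel_def)
  qed
qed (auto simp: LC_rel_def refl_on_def sym_def elim: eventually_mono)

lemma equiv_Lp_loc_rel: "equiv (Lp_loc_functions p) (Lp_loc_rel p)"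
proof (rule equivI)
  show "trans (Lp_loc_rel p)"
  proof (rule transI)
    fix f g h
    assume "(f, g) \<in> Lp_loc_rel p" "(g, h) \<in> Lp_loc_rel p"
    then have fh: "f \<in> Lp_loc_functions p" "h \<in> Lp_loc_functions p"
      and eq: "AE t in lebesgue. f t = g t" "AE t in lebesgue. g t = h t"
      by (auto simp: Lp_loc_rel_def)
    from eq have "AE t in lebesgue. f t = h t"
      by eventually_elim simp
    with fh show "(f, h) \<in> Lp_loc_rel p"
      by (simp add: Lp_loc_rel_def)
  qed
qed (auto simp: Lp_loc_rel_def refl_on_def sym_def elim: eventually_mono)

lemma LC_representative: "F \<in> LC_space p \<Longrightarrow> representative F \<in> LC_functions p"
  unfolding LC_space_def by (rule quotient_representative(1)[OF equiv_LC_rel])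

lemma Lp_loc_representative: "F \<in> Lp_loc_space p \<Longrightarrow> representative F \<in> Lp_loc_functions p"
  unfolding Lp_loc_space_def by (rule quotient_representative(1)[OF equiv_Lp_loc_rel])

lemma LC_space_eqI:
  assumes F: "F \<in> LC_space p" and G: "G \<in> LC_space p"
    and eq: "AE z in lebesgue. representative F z = representative G z"
  shows "F = G"
proof -
  have "(representative F, representative G) \<in> LC_rel p"
    using assms by (simp add: LC_rel_def LC_representative)
  then have "LC_rel p `` {representative F} = LC_rel p `` {representative G}"
    by (rule equiv_class_eq[OF equiv_LC_rel])
  then show ?thesis
    using quotient_representative(2)[OF equiv_LC_rel] F G unfolding LC_space_def by metis
qed

lemma Lp_loc_space_eqI:
  assumes F: "F \<in> Lp_loc_space p" and G: "G \<in> Lp_loc_space p"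
    and eq: "AE t in lebesgue. representative F t = representative G t"
  shows "F = G"
proof -
  have "(representative F, representative G) \<in> Lp_loc_rel p"
    using assms by (simp add: Lp_loc_rel_def Lp_loc_representative)
  then have "Lp_loc_rel p `` {representative F} = Lp_loc_rel p `` {representative G}"
    by (rule equiv_class_eq[OF equiv_Lp_loc_rel])
  then show ?thesis
    using quotient_representative(2)[OF equiv_Lp_loc_rel] F G unfolding Lp_loc_space_def by metis
qed

lemma slice_class:
  fixes F :: "(real \<times> (real ^ 'n) \<Rightarrow> real ^ 'm) set"
  assumes "1 \<le> p" "F \<in> LC_space p"
  shows "slice p x F \<in> Lp_loc_space p"
    and "AE t in lebesgue. representative (slice p x F) t = representative F (t, x)"
proof -
  have slice: "(\<lambda>t. representative F (t, x)) \<in> Lp_loc_functions p"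
    using assms by (intro LC_slice_in_Lp_loc LC_representative)
  then show "slice p x F \<in> Lp_loc_space p"
    unfolding Lp_loc_space_def slice_def by (rule quotientI)
  show "AE t in lebesgue. representative (slice p x F) t = representative F (t, x)"
    using representative_of_class[OF equiv_Lp_loc_rel slice]
    by (auto simp: slice_def Lp_loc_rel_def elim: eventually_mono)
qed

lemma p_norm_mono_interval:
  assumes p: "1 \<le> p" and u: "u \<in> Lp_loc_functions p" and sub: "{a..b} \<subseteq> {c..d}"
  shows "p_norm p (lebesgue_on {a..b}) u \<le> p_norm p (lebesgue_on {c..d}) u"
proof -
  have "integrable lebesgue (\<lambda>t. indicator {c..d} t *\<^sub>R (norm (u t) powr p))"
    using u by (intro integrable_restrict_space[THEN iffD1]) (simp_all add: Lp_loc_functions_def)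
  then have "(\<integral>t. norm (u t) powr p \<partial>lebesgue_on {a..b}) \<le> (\<integral>t. norm (u t) powr p \<partial>lebesgue_on {c..d})"
    using sub
    by (subst (1 2) integral_restrict_space)
      (auto intro!: integral_mono_AE' AE_I2 simp: indicator_def)
  then show ?thesis
    using p unfolding p_norm_def by (intro powr_mono2) (auto simp: integral_nonneg_AE)
qed

lemma real_interval_subset: "\<exists>m. {a..b} \<subseteq> {- real m..real m}"
proof -
  obtain m where "max \<bar>a\<bar> \<bar>b\<bar> \<le> real m"
    using real_arch_simple by blast
  then show ?thesis
    by (intro exI[of _ m]) auto
qed

lemma AE_eq_if_intervals:
  assumes "\<And>m. AE t in lebesgue_on {- real m..real m}. P t"
  shows "AE t in lebesgue. P t"
proof -
  have "AE t in lebesgue. \<forall>m. t \<in> {- real m..real m} \<longrightarrow> P t"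
    unfolding AE_all_countable using assms by (simp add: AE_restrict_space_iff)
  then show ?thesis
  proof eventually_elim
    case (elim t)
    then show ?case
      using real_interval_subset[of t t] by auto
  qed
qed

text \<open>The topology of \<open>Lp_loc_space p\<close> is given by uncountably many intervals, but those of the
  form \<open>[-m, m]\<close> dominate the others.\<close>

lemma relatively_compact_in_Lp_loc_iff:
  fixes A :: "(real \<Rightarrow> 'b::euclidean_space) set set"
  assumes p: "1 \<le> p"
  shows "relatively_compact_in (Lp_loc_topology p) A \<longleftrightarrow> A \<subseteq> Lp_loc_space p \<and>
    (\<forall>s::nat \<Rightarrow> _. range s \<subseteq> A \<longrightarrow> (\<exists>r L. strict_mono r \<and> L \<in> Lp_loc_space p \<and>
      (\<forall>m. (\<lambda>n. p_norm p (lebesgue_on {- real m..real m})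
        (\<lambda>t. representative (s (r n)) t - representative L t)) \<longlonglongrightarrow> 0)))"
proof -
  define Q :: "((real \<Rightarrow> 'b) \<Rightarrow> real) set" where "Q = {Lp_seminorm p {a..b} | a b. a \<le> b}"
  define N :: "nat \<Rightarrow> (real \<Rightarrow> 'b) \<Rightarrow> real" where "N m = Lp_seminorm p {- real m..real m}" for m
  define d :: "((real \<Rightarrow> 'b) \<Rightarrow> real) \<Rightarrow> (real \<Rightarrow> 'b) set \<Rightarrow> (real \<Rightarrow> 'b) set \<Rightarrow> real"
    where "d q F G = q (\<lambda>t. representative G t - representative F t)" for q F G
  have integrable: "p_integrable p (lebesgue_on {a..b}) (representative F)"
    if "F \<in> Lp_loc_space p" for F :: "(real \<Rightarrow> 'b) set" and a b
    using Lp_loc_representative[OF that] by (simp add: Lp_loc_functions_iff)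
  have diff: "(\<lambda>t. representative F t - representative G t) \<in> Lp_loc_functions p"
    if "F \<in> Lp_loc_space p" "G \<in> Lp_loc_space p" for F G :: "(real \<Rightarrow> 'b) set"
    using integrable that p by (simp add: Lp_loc_functions_iff p_integrable_diff)
  have NQ: "range N \<subseteq> Q"
  proof (rule image_subsetI)
    show "N m \<in> Q" for m
      unfolding N_def Q_def by (intro CollectI exI[of _ "- real m"] exI[of _ "real m"]) simp
  qed
  have dominated: "\<exists>m. \<forall>F\<in>Lp_loc_space p. \<forall>G\<in>Lp_loc_space p. d q F G \<le> d (N m) F G" if q: "q \<in> Q" for q
  proof -
    obtain a b m where "q = Lp_seminorm p {a..b}" "{a..b} \<subseteq> {- real m..real m}"
      using q real_interval_subset unfolding Q_def by blast
    then show ?thesis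
      using p_norm_mono_interval[OF p diff] unfolding d_def N_def Lp_seminorm_eq_p_norm by blast
  qed
  have sequences: "relatively_compact_in (Lp_loc_topology p) A \<longleftrightarrow> A \<subseteq> Lp_loc_space p \<and>
    (\<forall>s::nat \<Rightarrow> _. range s \<subseteq> A \<longrightarrow>
      (\<exists>r L. strict_mono r \<and> L \<in> Lp_loc_space p \<and> (\<forall>q\<in>Q. (\<lambda>n. d q L (s (r n))) \<longlonglongrightarrow> 0)))"
    unfolding Lp_loc_topology_def Q_def[symmetric]
  proof (rule relatively_compact_in_seminorm_topology_iff[where \<delta> = N and d = d, OF d_def])
    fix q and F G H :: "(real \<Rightarrow> 'b) set"
    assume q: "q \<in> Q" and F: "F \<in> Lp_loc_space p"
    from q obtain a b where q': "q = Lp_seminorm p {a..b}"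
      unfolding Q_def by blast
    show "d q F F = 0"
      using p by (simp add: d_def q' Lp_seminorm_eq_p_norm p_norm_def)
    assume G: "G \<in> Lp_loc_space p"
    show "d q F G = d q G F"
      unfolding d_def q' Lp_seminorm_eq_p_norm by (rule p_norm_minus_commute)
    assume H: "H \<in> Lp_loc_space p"
    show "d q F H \<le> d q F G + d q G H"
      using p_norm_diff_triangle[OF p integrable[OF H] integrable[OF G] integrable[OF F], of a b]
      by (simp add: d_def q' Lp_seminorm_eq_p_norm)
  next
    fix F G :: "(real \<Rightarrow> 'b) set"
    assume F: "F \<in> Lp_loc_space p" and G: "G \<in> Lp_loc_space p" and zero: "\<And>k. d (N k) F G = 0"
    have "AE t in lebesgue_on {- real m..real m}. representative F t = representative G t" for m
    proof -
      have "p_integrable p (lebesgue_on {- real m..real m}) (\<lambda>t. representative G t - representative F t)"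
        using diff[OF G F] by (simp add: Lp_loc_functions_iff)
      with zero[of m] have "AE t in lebesgue_on {- real m..real m}. representative G t - representative F t = 0"
        by (simp add: d_def N_def Lp_seminorm_eq_p_norm p_norm_eq_0_iff[OF p])
      then show ?thesis
        by eventually_elim simp
    qed
    then show "F = G"
      by (intro Lp_loc_space_eqI[OF F G] AE_eq_if_intervals)
  qed (fact NQ dominated)+
  have limits: "(\<forall>q\<in>Q. (\<lambda>n. d q L (s (r n))) \<longlonglongrightarrow> 0) \<longleftrightarrow>
      (\<forall>m. (\<lambda>n. d (N m) L (s (r n))) \<longlonglongrightarrow> 0)"
    if A: "A \<subseteq> Lp_loc_space p" and s: "range s \<subseteq> A" and L: "L \<in> Lp_loc_space p"
    for s L and r :: "nat \<Rightarrow> nat"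
  proof (intro iffI ballI allI)
    fix q
    assume lim: "\<forall>m. (\<lambda>n. d (N m) L (s (r n))) \<longlonglongrightarrow> 0" and q: "q \<in> Q"
    obtain m where m: "\<forall>F\<in>Lp_loc_space p. \<forall>G\<in>Lp_loc_space p. d q F G \<le> d (N m) F G"
      using dominated[OF q] by blast
    have "0 \<le> d q L (s (r n)) \<and> d q L (s (r n)) \<le> d (N m) L (s (r n))" for n
    proof
      show "0 \<le> d q L (s (r n))"
        using q by (auto simp: d_def Q_def Lp_seminorm_def)
      show "d q L (s (r n)) \<le> d (N m) L (s (r n))"
        using m A s L by blast
    qed
    then show "(\<lambda>n. d q L (s (r n))) \<longlonglongrightarrow> 0"
      by (intro tendsto_sandwich[OF _ _ tendsto_const lim[rule_format, of m]]) auto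
  qed (use NQ in blast)
  show ?thesis
  proof (cases "A \<subseteq> Lp_loc_space p")
    case True
    have "(\<exists>r L. strict_mono r \<and> L \<in> Lp_loc_space p \<and> (\<forall>q\<in>Q. (\<lambda>n. d q L (s (r n))) \<longlonglongrightarrow> 0)) \<longleftrightarrow>
        (\<exists>r L. strict_mono r \<and> L \<in> Lp_loc_space p \<and>
          (\<forall>m. (\<lambda>n. p_norm p (lebesgue_on {- real m..real m})
            (\<lambda>t. representative (s (r n)) t - representative L t)) \<longlonglongrightarrow> 0))"
      if "range s \<subseteq> A" for s :: "nat \<Rightarrow> _"
      using limits[OF True that] unfolding d_def N_def Lp_seminorm_eq_p_norm
      by (intro ex_cong1 conj_cong refl)
    then show ?thesis
      unfolding sequences by (intro arg_cong[where f = "\<lambda>x. A \<subseteq> Lp_loc_space p \<and> x"] all_cong1 imp_cong refl)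
  qed (simp add: sequences)
qed

text \<open>All three topologies are generated by suprema of \<open>p\<close>-norms over countably many sets of curves;
  for \<open>T_D\<close> these sets are singletons consisting of a constant curve. The last condition makes the
  topology finer than \<open>T_D\<close>, and the inclusion in some \<open>continuous_curves I j\<close> makes it coarser
  than \<open>T_B\<close>.\<close>

definition curve_family :: "(real ^ 'n) set \<Rightarrow> (real set \<times> (real \<Rightarrow> real ^ 'n) set) set \<Rightarrow> bool"
  where "curve_family D \<C> \<longleftrightarrow> countable \<C> \<and>
    (\<forall>(I, C)\<in>\<C>. I \<in> rational_intervals \<and> C \<noteq> {} \<and> (\<exists>j. C \<subseteq> continuous_curves I j)) \<and>
    (\<forall>I\<in>rational_intervals. \<forall>x\<in>D. \<exists>C. (I, C) \<in> \<C> \<and> (\<lambda>_. x) \<in> C)"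

definition curve_topology ::
    "real \<Rightarrow> (real set \<times> (real \<Rightarrow> real ^ 'n) set) set \<Rightarrow> (real \<times> (real ^ 'n) \<Rightarrow> real ^ 'm) set topology"
  where "curve_topology p \<C> =
    seminorm_topology (LC_space p) ((\<lambda>(I, C). curve_seminorm p I C) ` \<C>)"

lemma countable_rational_intervals: "countable rational_intervals"
proof -
  have "rational_intervals \<subseteq> (\<lambda>(a, b). {a..b}) ` (\<rat> \<times> \<rat>)"
    by (auto simp: rational_intervals_def)
  then show ?thesis
    by (rule countable_subset) (intro countable_image countable_SIGMA countable_rat)
qed

lemma interval_in_rational_intervals: "{- real m..real m} \<in> rational_intervals"
  unfolding rational_intervals_def by (auto intro!: exI[of _ "- real m"] exI[of _ "real m"])

lemma topology_from_curve_family: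
  fixes D :: "(real ^ 'n) set" and T :: "(real \<times> (real ^ 'n) \<Rightarrow> real ^ 'm) set topology"
  assumes D: "countable D"
    and T: "T = T_D p D \<or> (\<exists>\<theta>. suitable_moduli \<theta> \<and> T = T_Theta p \<theta>) \<or> T = T_B p"
  obtains \<C> where "curve_family D \<C>" "T = curve_topology p \<C>"
proof -
  have indexed: "\<exists>\<C>. curve_family D \<C> \<and> T = curve_topology p \<C>"
    if T': "T = seminorm_topology (LC_space p) {curve_seminorm p I (\<K> I j) | I j. I \<in> rational_intervals}"
      and sub: "\<And>I j. \<K> I j \<subseteq> continuous_curves I j"
      and const: "\<And>I j x. I \<in> rational_intervals \<Longrightarrow> norm x \<le> real j \<Longrightarrow> (\<lambda>_. x) \<in> \<K> I j"
    for \<K> :: "real set \<Rightarrow> nat \<Rightarrow> (real \<Rightarrow> real ^ 'n) set"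
  proof (intro exI conjI)
    let ?\<C> = "(\<lambda>(I, j). (I, \<K> I j)) ` (rational_intervals \<times> UNIV)"
    have "\<exists>C. (I, C) \<in> ?\<C> \<and> (\<lambda>_. x) \<in> C" if "I \<in> rational_intervals" for I and x :: "real ^ 'n"
    proof -
      obtain j where "norm x \<le> real j"
        using real_arch_simple by blast
      then have "(\<lambda>_. x) \<in> \<K> I j"
        by (rule const[OF that])
      moreover have "(I, \<K> I j) \<in> ?\<C>"
        using that by (intro image_eqI[of _ _ "(I, j)"]) auto
      ultimately show ?thesis
        by blast
    qed
    moreover have "\<K> I j \<noteq> {}" if "I \<in> rational_intervals" for I j
      using const[OF that, of 0 j] by auto
    moreover have "countable ?\<C>"
      by (intro countable_image countable_SIGMA countable_rational_intervals) simp
    ultimately show "curve_family D ?\<C>"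
      using sub unfolding curve_family_def by fast
    show "T = curve_topology p ?\<C>"
      unfolding T' curve_topology_def by (intro arg_cong[where f = "seminorm_topology _"]) force
  qed
  consider "T = T_D p D" | \<theta> where "suitable_moduli \<theta>" "T = T_Theta p \<theta>" | "T = T_B p"
    using T by blast
  then have "\<exists>\<C>. curve_family D \<C> \<and> T = curve_topology p \<C>"
  proof cases
    case 1
    let ?\<C> = "(\<lambda>(I, x). (I, {\<lambda>_. x})) ` (rational_intervals \<times> D)"
    have "\<exists>j. {\<lambda>_. x} \<subseteq> continuous_curves I j" for I and x :: "real ^ 'n"
      using constant_curve real_arch_simple by fast
    moreover have "countable ?\<C>"
      by (intro countable_image countable_SIGMA countable_rational_intervals D)
    ultimately have "curve_family D ?\<C>"
      unfolding curve_family_def by fast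
    moreover have "T = curve_topology p ?\<C>"
      unfolding 1 curve_topology_def T_D_def
      by (intro arg_cong[where f = "seminorm_topology _"]) (force simp: curve_seminorm_def image_iff)
    ultimately show ?thesis
      by blast
  next
    case (2 \<theta>)
    show ?thesis
    proof (rule indexed)
      show "T = seminorm_topology (LC_space p)
          {curve_seminorm p I (modulus_curves \<theta> I j) | I j. I \<in> rational_intervals}"
        by (simp add: 2 T_Theta_def)
      show "modulus_curves \<theta> I j \<subseteq> continuous_curves I j" for I j
        by (auto simp: modulus_curves_def)
      show "(\<lambda>_. x) \<in> modulus_curves \<theta> I j" if "I \<in> rational_intervals" "norm x \<le> real j" for I j and x :: "real ^ 'n"
      proof -
        have "\<theta> I j ` {0..} \<subseteq> {0..}"
          using 2(1) that(1) unfolding suitable_moduli_def by blast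
        then have "0 \<le> \<theta> I j \<bar>s - t\<bar>" for s t
          by (simp add: image_subset_iff)
        then show ?thesis
          using constant_curve[OF that(2), of I] by (simp add: modulus_curves_def)
      qed
    qed
  next
    case 3
    show ?thesis
      by (rule indexed[of continuous_curves]) (simp_all add: 3 T_B_def constant_curve)
  qed
  then show ?thesis
    using that by blast
qed

text \<open>Points are separated because the family of curves contains the constant curves through a dense
  set.\<close>

lemma relatively_compact_in_curve_topology_iff:
  fixes D :: "(real ^ 'n) set" and A :: "(real \<times> (real ^ 'n) \<Rightarrow> real ^ 'm) set set"
  assumes p: "1 \<le> p" and D: "countable D" "closure D = UNIV" and \<C>: "curve_family D \<C>"
  shows "relatively_compact_in (curve_topology p \<C>) A \<longleftrightarrow> A \<subseteq> LC_space p \<and>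
    (\<forall>s::nat \<Rightarrow> _. range s \<subseteq> A \<longrightarrow> (\<exists>r L. strict_mono r \<and> L \<in> LC_space p \<and>
      (\<forall>(I, C)\<in>\<C>. (\<lambda>n. curve_seminorm p I C
        (\<lambda>z. representative (s (r n)) z - representative L z)) \<longlonglongrightarrow> 0)))"
proof -
  define Q :: "((real \<times> (real ^ 'n) \<Rightarrow> real ^ 'm) \<Rightarrow> real) set"
    where "Q = (\<lambda>(I, C). curve_seminorm p I C) ` \<C>"
  define d :: "((real \<times> (real ^ 'n) \<Rightarrow> real ^ 'm) \<Rightarrow> real) \<Rightarrow> (real \<times> (real ^ 'n) \<Rightarrow> real ^ 'm) set \<Rightarrow>
      (real \<times> (real ^ 'n) \<Rightarrow> real ^ 'm) set \<Rightarrow> real"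
    where "d q F G = q (\<lambda>t. representative G t - representative F t)" for q F G
  have D_nonempty: "D \<noteq> {}"
    using D(2) by auto
  then have "Q \<noteq> {}"
    using \<C> interval_in_rational_intervals[of 0] unfolding curve_family_def Q_def by blast
  moreover have "countable Q"
    using \<C> by (simp add: curve_family_def Q_def)
  ultimately have range: "range (from_nat_into Q) = Q"
    by (rule range_from_nat_into)
  have member: "\<exists>a b C j. q = curve_seminorm p {a..b} C \<and> C \<noteq> {} \<and> C \<subseteq> continuous_curves {a..b} j"
    if "q \<in> Q" for q
    using that \<C> unfolding Q_def curve_family_def rational_intervals_def by fast
  have "relatively_compact_in (curve_topology p \<C>) A \<longleftrightarrow> A \<subseteq> LC_space p \<and>
    (\<forall>s::nat \<Rightarrow> _. range s \<subseteq> A \<longrightarrow>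
      (\<exists>r L. strict_mono r \<and> L \<in> LC_space p \<and> (\<forall>q\<in>Q. (\<lambda>n. d q L (s (r n))) \<longlonglongrightarrow> 0)))"
    unfolding curve_topology_def Q_def[symmetric]
  proof (rule relatively_compact_in_seminorm_topology_iff[where \<delta> = "from_nat_into Q" and d = d, OF d_def])
    fix q and F G H :: "(real \<times> (real ^ 'n) \<Rightarrow> real ^ 'm) set"
    assume q: "q \<in> Q" and F: "F \<in> LC_space p"
    from member[OF q] obtain a b C j where q': "q = curve_seminorm p {a..b} C"
      and C: "C \<subseteq> continuous_curves {a..b} j" "C \<noteq> {}"
      by blast
    show "d q F F = 0"
      using p C(2) by (simp add: d_def q' curve_seminorm_def Lp_seminorm_eq_p_norm p_norm_def)
    assume G: "G \<in> LC_space p"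
    show "d q F G = d q G F"
      by (simp add: d_def q' curve_seminorm_def Lp_seminorm_def norm_minus_commute)
    assume H: "H \<in> LC_space p"
    show "d q F H \<le> d q F G + d q G H"
      using curve_seminorm_triangle[OF p LC_representative[OF H] LC_representative[OF G]
          LC_representative[OF F] C]
      by (simp add: d_def q')
  next
    show "range (from_nat_into Q) \<subseteq> Q"
      using range by simp
    show "\<exists>k. \<forall>F\<in>LC_space p. \<forall>G\<in>LC_space p. d q F G \<le> d (from_nat_into Q k) F G" if "q \<in> Q" for q
    proof -
      have "q \<in> range (from_nat_into Q)"
        using that by (simp only: range)
      then obtain k where "q = from_nat_into Q k"
        by (rule rangeE)
      then show ?thesis
        by blast
    qed
  next
    fix F G :: "(real \<times> (real ^ 'n) \<Rightarrow> real ^ 'm) set"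
    assume F: "F \<in> LC_space p" and G: "G \<in> LC_space p"
      and zero: "\<And>k. d (from_nat_into Q k) F G = 0"
    let ?f = "representative F" and ?g = "representative G"
    have f: "?f \<in> LC_functions p" and g: "?g \<in> LC_functions p"
      using F G by (simp_all add: LC_representative)
    have zero_Q: "d q F G = 0" if "q \<in> Q" for q
    proof -
      have "q \<in> range (from_nat_into Q)"
        using that by (simp only: range)
      then show ?thesis
        using zero by (elim rangeE) simp
    qed
    have "AE t in lebesgue. ?f (t, x) = ?g (t, x)" if x: "x \<in> D" for x
    proof (rule AE_eq_if_intervals)
      fix m
      let ?I = "{- real m..real m}"
      obtain C where C: "(?I, C) \<in> \<C>" "(\<lambda>_. x) \<in> C"
        using \<C> x interval_in_rational_intervals[of m] unfolding curve_family_def by blast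
      then obtain j where j: "C \<subseteq> continuous_curves ?I j"
        using \<C> unfolding curve_family_def by fast
      have "p_norm p (lebesgue_on ?I) (\<lambda>t. ?g (t, x) - ?f (t, x)) \<le> curve_seminorm p ?I C (\<lambda>z. ?g z - ?f z)"
        using curve_p_norm_le_curve_seminorm[OF p LC_diff[OF p g f] j C(2)] by simp
      also have "\<dots> = d (curve_seminorm p ?I C) F G"
        by (simp add: d_def)
      also have "\<dots> = 0"
        using C(1) by (intro zero_Q) (force simp: Q_def)
      finally have "p_norm p (lebesgue_on ?I) (\<lambda>t. ?g (t, x) - ?f (t, x)) = 0"
        using p_norm_nonneg by (intro antisym)
      moreover have "p_integrable p (lebesgue_on ?I) (\<lambda>t. ?g (t, x) - ?f (t, x))"
        using LC_slice_in_Lp_loc[OF p LC_diff[OF p g f]] by (simp add: Lp_loc_functions_iff)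
      ultimately have "AE t in lebesgue_on ?I. ?g (t, x) - ?f (t, x) = 0"
        by (simp add: p_norm_eq_0_iff[OF p])
      then show "AE t in lebesgue_on ?I. ?f (t, x) = ?g (t, x)"
        by eventually_elim simp
    qed
    then show "F = G"
      by (intro LC_space_eqI[OF F G] LC_AE_eq_if_dense[OF f g D])
  qed
  then show ?thesis
    by (simp add: Q_def d_def case_prod_unfold)
qed

section \<open>Convergence along curves from convergence on a dense set\<close>

lemma p_integrable_sum:
  assumes "1 \<le> p" "finite F" "\<And>i. i \<in> F \<Longrightarrow> p_integrable p M (u i)"
  shows "p_integrable p M (\<lambda>t. \<Sum>i\<in>F. u i t)"
  using assms(2,3)
proof induction
  case empty
  then show ?case
    using assms(1) by (simp add: p_integrable_def)
next
  case (insert i F)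
  then show ?case
    by (simp add: p_integrable_add assms(1))
qed

lemma p_norm_sum_le:
  assumes "1 \<le> p" "finite F" "\<And>i. i \<in> F \<Longrightarrow> p_integrable p M (u i)"
  shows "p_norm p M (\<lambda>t. \<Sum>i\<in>F. u i t) \<le> (\<Sum>i\<in>F. p_norm p M (u i))"
  using assms(2,3)
proof induction
  case empty
  then show ?case
    using assms(1) by (simp add: p_norm_def)
next
  case (insert i F)
  then have "p_norm p M (\<lambda>t. u i t + (\<Sum>i\<in>F. u i t)) \<le> p_norm p M (u i) + p_norm p M (\<lambda>t. \<Sum>i\<in>F. u i t)"
    by (intro p_norm_add_le p_integrable_sum assms(1)) auto
  with insert show ?case
    by simp
qed

lemma p_norm_cmult:
  fixes u :: "'a \<Rightarrow> real"
  assumes "1 \<le> p"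
  shows "p_norm p M (\<lambda>t. c * u t) = \<bar>c\<bar> * p_norm p M u"
  using assms by (simp add: p_norm_def abs_mult powr_mult powr_powr integral_nonneg_AE)

lemma p_norm_of_norm: "p_norm p M (\<lambda>t. norm (u t)) = p_norm p M u"
  by (simp add: p_norm_def)

lemma p_integrable_if_nn_integral_le:
  assumes p: "1 \<le> p" and u: "u \<in> borel_measurable M" and K: "0 \<le> K"
    and le: "(\<integral>\<^sup>+t. ennreal (norm (u t) powr p) \<partial>M) \<le> ennreal K"
  shows "p_integrable p M u" "p_norm p M u \<le> K powr (1 / p)"
proof -
  have "(\<integral>\<^sup>+t. ennreal (norm (u t) powr p) \<partial>M) < \<infinity>"
    using le by (rule order_le_less_trans) simp
  then have int: "integrable M (\<lambda>t. norm (u t) powr p)"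
    using u by (intro integrableI_bounded) auto
  then show "p_integrable p M u"
    using u by (simp add: p_integrable_def)
  have "ennreal (\<integral>t. norm (u t) powr p \<partial>M) \<le> ennreal K"
    using le by (subst nn_integral_eq_integral[OF int, symmetric]) auto
  then have "(\<integral>t. norm (u t) powr p \<partial>M) \<le> K"
    using K by (simp add: ennreal_le_iff)
  then show "p_norm p M u \<le> K powr (1 / p)"
    using p unfolding p_norm_def by (intro powr_mono2) (auto simp: integral_nonneg_AE)
qed

lemma lipschitz_bound_on_closure:
  fixes f :: "'a::real_normed_vector \<Rightarrow> 'b::real_normed_vector"
  assumes f: "continuous_on UNIV f"
    and S: "\<And>x y. x \<in> S \<Longrightarrow> y \<in> S \<Longrightarrow> norm (f x - f y) \<le> c * norm (x - y)"
    and xy: "x \<in> closure S" "y \<in> closure S"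
  shows "norm (f x - f y) \<le> c * norm (x - y)"
proof -
  have "continuous_on UNIV (\<lambda>z. f (fst z))" "continuous_on UNIV (\<lambda>z. f (snd z))"
    using f by (auto intro!: continuous_on_compose2[OF f] continuous_intros)
  then have "closed {z. norm (f (fst z) - f (snd z)) \<le> c * norm (fst z - snd z)}"
    by (intro closed_Collect_le continuous_intros)
  then have "closure (S \<times> S) \<subseteq> {z. norm (f (fst z) - f (snd z)) \<le> c * norm (fst z - snd z)}"
    using S by (intro closure_minimal) auto
  then show ?thesis
    using xy by (auto simp: closure_Times)
qed

text \<open>The optimal bound is a supremum over uncountably many pairs of points and need not be
  measurable. Taking the supremum over a countable dense set of pairs gives a Borel
  function that is no larger, and by continuity it is still a Lipschitz bound for almost
  every \<open>t\<close>.\<close>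

lemma measurable_lipschitz_bound:
  fixes f :: "real \<times> (real ^ 'n) \<Rightarrow> real ^ 'm" and D :: "(real ^ 'n) set"
  assumes p: "1 \<le> p" and f: "f \<in> LC_functions p" and D: "countable D" "closure D = UNIV"
  obtains \<rho> where "\<rho> \<in> borel_measurable borel" "\<And>t. 0 \<le> \<rho> t"
    "AE t in lebesgue. \<forall>x\<in>cball 0 (real j). \<forall>y\<in>cball 0 (real j).
      norm (f (t, x) - f (t, y)) \<le> \<rho> t * norm (x - y)"
    "\<And>t. ennreal (\<rho> t powr p) \<le> ennreal_powr (l_bound f j t) p"
proof -
  define B where "B = ball 0 (real j) \<inter> D"
  define P where "P = {(x, y). x \<in> B \<and> y \<in> B \<and> x \<noteq> y}"
  define q where "q t z = norm (f (t, fst z) - f (t, snd z)) / norm (fst z - snd z)" for t z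
  define S where "S t = (SUP z\<in>P. ennreal (q t z))" for t
  have "P \<subseteq> D \<times> D"
    by (auto simp: P_def B_def)
  then have P: "countable P"
    by (rule countable_subset) (intro countable_SIGMA D(1))
  have f_meas: "f \<in> borel_measurable borel"
    using f by (rule LC_borel_measurable)
  have slice: "(\<lambda>t. f (t, x)) \<in> borel_measurable borel" for x
    by (intro measurable_compose[OF _ f_meas] borel_measurable_continuous_onI continuous_intros)
  have "(\<lambda>t. q t z) \<in> borel_measurable borel" for z
    unfolding q_def using slice by (intro borel_measurable_divide borel_measurable_norm borel_measurable_diff) auto
  then have S_meas: "S \<in> borel_measurable borel"
    unfolding S_def using P by (intro borel_measurable_SUP) auto
  show ?thesis
  proof (rule that[of "\<lambda>t. enn2real (S t)"])
    show "(\<lambda>t. enn2real (S t)) \<in> borel_measurable borel"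
      using S_meas by simp
    show "0 \<le> enn2real (S t)" for t
      by simp
    show "ennreal (enn2real (S t) powr p) \<le> ennreal_powr (l_bound f j t) p" for t
    proof (cases "S t = \<infinity> \<or> l_bound f j t = \<infinity>")
      case True
      then show ?thesis
        by (auto simp: ennreal_powr_def)
    next
      case False
      have "S t \<le> l_bound f j t"
        unfolding S_def l_bound_def
        by (rule SUP_subset_mono) (auto simp: P_def B_def q_def)
      then have "enn2real (S t) \<le> enn2real (l_bound f j t)"
        using False by (intro enn2real_mono) (auto simp: less_top)
      then show ?thesis
        using False p by (auto simp: ennreal_powr_def intro!: powr_mono2)
    qed
    from LC_lipschitz[OF f compact_cball] obtain l where
      "AE t in lebesgue. \<forall>x\<in>cball 0 (real j). \<forall>y\<in>cball 0 (real j).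
        norm (f (t, x) - f (t, y)) \<le> l t * norm (x - y)"
      by blast
    then show "AE t in lebesgue. \<forall>x\<in>cball 0 (real j). \<forall>y\<in>cball 0 (real j).
        norm (f (t, x) - f (t, y)) \<le> enn2real (S t) * norm (x - y)"
      using LC_AE_continuous[OF f]
    proof eventually_elim
      case (elim t)
      have "q t z \<le> l t" if "z \<in> P" for z
      proof -
        have "norm (f (t, fst z) - f (t, snd z)) \<le> l t * norm (fst z - snd z)" "fst z \<noteq> snd z"
          using elim(1) that by (auto simp: P_def B_def)
        then show ?thesis
          by (simp add: q_def pos_divide_le_eq)
      qed
      then have "S t \<le> ennreal (l t)"
        unfolding S_def by (intro SUP_least ennreal_leI)
      then have finite: "S t < \<infinity>"
        by (rule order_le_less_trans) simp
      have on_B: "norm (f (t, x) - f (t, y)) \<le> enn2real (S t) * norm (x - y)" if "x \<in> B" "y \<in> B" for x y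
      proof (cases "x = y")
        case False
        then have "(x, y) \<in> P"
          using that by (simp add: P_def)
        then have "ennreal (q t (x, y)) \<le> S t"
          unfolding S_def by (rule SUP_upper)
        then have "q t (x, y) \<le> enn2real (S t)"
          using finite by (cases "S t") (auto simp: q_def)
        then show ?thesis
          using False by (simp add: q_def pos_divide_le_eq)
      qed simp
      \<comment> \<open>For \<open>j = 0\<close> the open ball is empty, while the closed ball consists of the origin.\<close>
      have closure: "closure B = cball 0 (real j)" if "0 < j"
        unfolding B_def using D(2) that by (subst closure_open_Int_superset) auto
      show ?case
      proof (cases "j = 0")
        case False
        then show ?thesis
          using lipschitz_bound_on_closure[OF elim(2) on_B] closure by simp
      qed simp
    qed
  qed
qed

text \<open>A finite net \<open>F\<close> of mesh \<open>\<delta>\<close> in a ball replaces an arbitrary curve by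
  finitely many constant ones: at each time the difference along the curve is at most the sum of the
  differences at the points of \<open>F\<close> plus \<open>\<delta>\<close> times the two Lipschitz bounds. This estimate does not
  depend on the curve, which is why convergence on a dense set implies uniform convergence over all
  curves in a ball.\<close>

lemma curve_convergence_if_dense_convergence:
  fixes f :: "nat \<Rightarrow> real \<times> (real ^ 'n) \<Rightarrow> real ^ 'm"
  assumes p: "1 \<le> p" and D: "closure D = UNIV"
    and f: "\<And>n. f n \<in> LC_functions p" and g: "g \<in> LC_functions p"
    and \<rho>: "\<And>n. \<rho> n \<in> borel_measurable borel" "\<And>n t. 0 \<le> \<rho> n t"
    and lipschitz: "\<And>n. AE t in lebesgue. \<forall>x\<in>cball 0 (real (Suc j)). \<forall>y\<in>cball 0 (real (Suc j)).
      norm (f n (t, x) - f n (t, y)) \<le> \<rho> n t * norm (x - y)"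
    and K: "0 \<le> K" "\<And>n. (\<integral>\<^sup>+t. ennreal (\<rho> n t powr p) \<partial>lebesgue_on {a..b}) \<le> ennreal K"
    and conv: "\<And>x. x \<in> D \<Longrightarrow> (\<lambda>n. p_norm p (lebesgue_on {a..b}) (\<lambda>t. f n (t, x) - g (t, x))) \<longlonglongrightarrow> 0"
    and C: "C \<subseteq> continuous_curves {a..b} j" "C \<noteq> {}"
  shows "(\<lambda>n. curve_seminorm p {a..b} C (\<lambda>z. f n z - g z)) \<longlonglongrightarrow> 0"
proof (rule metric_LIMSEQ_I)
  fix e :: real
  assume e: "0 < e"
  let ?M = "lebesgue_on {a..b}"
  from LC_lipschitz[OF g compact_cball] obtain l where l: "l \<in> Lp_loc_functions p"
    and g_lipschitz: "AE t in lebesgue. \<forall>x\<in>cball 0 (real (Suc j)). \<forall>y\<in>cball 0 (real (Suc j)).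
      norm (g (t, x) - g (t, y)) \<le> l t * norm (x - y)" .
  have l_int: "p_integrable p ?M (\<lambda>t. \<bar>l t\<bar>)"
    using l p_integrable_norm[of p ?M l] by (simp add: Lp_loc_functions_iff)
  have \<rho>_int: "p_integrable p ?M (\<rho> n)" and \<rho>_le: "p_norm p ?M (\<rho> n) \<le> K powr (1 / p)" for n
  proof -
    have "\<rho> n \<in> borel_measurable ?M"
      using \<rho>(1)[of n] by (intro measurable_restrict_space1 measurable_completion) simp
    then show "p_integrable p ?M (\<rho> n)" "p_norm p ?M (\<rho> n) \<le> K powr (1 / p)"
      using p_integrable_if_nn_integral_le[OF p _ K(1), of "\<rho> n" ?M] K(2)[of n] \<rho>(2) by simp_all
  qed
  define B where "B = K powr (1 / p) + p_norm p ?M (\<lambda>t. \<bar>l t\<bar>) + 1"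
  have B: "0 < B"
    using p_norm_nonneg[of p ?M "\<lambda>t. \<bar>l t\<bar>"] by (simp add: B_def add_nonneg_pos)
  \<comment> \<open>Mesh at most 1, so that points of the net near the ball of radius \<open>j\<close> lie in the ball of radius
    \<open>j + 1\<close>, on which the Lipschitz bounds hold.\<close>
  define \<delta> where "\<delta> = min 1 (e / (2 * B))"
  have \<delta>: "0 < \<delta>" "\<delta> \<le> 1" "\<delta> * B \<le> e / 2"
    using e B by (auto simp: \<delta>_def min_def field_simps)
  have "cball 0 (real j) \<subseteq> (\<Union>y\<in>D. ball y \<delta>)"
  proof
    fix x :: "real ^ 'n"
    have "x \<in> closure D"
      using D by simp
    then show "x \<in> (\<Union>y\<in>D. ball y \<delta>)"
      using \<delta>(1) unfolding closure_approachable by (auto simp: mem_ball)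
  qed
  then obtain F where F: "F \<subseteq> D" "finite F" "cball 0 (real j) \<subseteq> (\<Union>y\<in>F. ball y \<delta>)"
    using compactE_image[OF compact_cball[of 0 "real j"], of D "\<lambda>y. ball y \<delta>"] by (metis open_ball)
  let ?\<Delta> = "\<lambda>n y t. norm (f n (t, y) - g (t, y))"
  have \<Delta>_int: "p_integrable p ?M (?\<Delta> n y)" for n y
    using LC_slice_in_Lp_loc[OF p LC_diff[OF p f g]] by (simp add: Lp_loc_functions_iff p_integrable_norm)
  have uniform: "curve_seminorm p {a..b} C (\<lambda>z. f n z - g z)
      \<le> (\<Sum>y\<in>F. p_norm p ?M (\<lambda>t. f n (t, y) - g (t, y))) + e / 2" for n
  proof (rule curve_seminorm_le[OF C(2)])
    fix x
    assume "x \<in> C"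
    then have x: "x t \<in> cball 0 (real j)" if "t \<in> {a..b}" for t
      using C(1) that unfolding continuous_curves_def by blast
    let ?V = "\<lambda>t. (\<Sum>y\<in>F. ?\<Delta> n y t) + \<delta> * (\<rho> n t + \<bar>l t\<bar>)"
    have sum_int: "p_integrable p ?M (\<lambda>t. \<Sum>y\<in>F. ?\<Delta> n y t)"
      by (intro p_integrable_sum p F(2) \<Delta>_int)
    have bound_int: "p_integrable p ?M (\<lambda>t. \<delta> * (\<rho> n t + \<bar>l t\<bar>))"
      by (intro p_integrable_cmult p_integrable_add p \<rho>_int l_int)
    have "AE t in ?M. t \<in> {a..b}"
      by (rule AE_I2) (simp add: space_restrict_space)
    with AE_lebesgue_on[OF lipschitz[of n]] AE_lebesgue_on[OF g_lipschitz]
    have "AE t in ?M. norm (f n (t, x t) - g (t, x t)) \<le> norm (?V t)"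
    proof eventually_elim
      case (elim t)
      have xt: "x t \<in> cball 0 (real j)"
        using elim(3) by (rule x)
      then obtain y where y: "y \<in> F" "dist y (x t) < \<delta>"
        using F(3) by auto
      have "norm y \<le> norm (x t) + dist y (x t)"
        by (metis dist_norm norm_triangle_sub)
      then have balls: "y \<in> cball 0 (real (Suc j))" "x t \<in> cball 0 (real (Suc j))"
        using xt y(2) \<delta>(2) by auto
      have f_le: "norm (f n (t, x t) - f n (t, y)) \<le> \<rho> n t * norm (x t - y)"
        using elim(1) balls by blast
      have "norm (g (t, y) - g (t, x t)) \<le> l t * norm (x t - y)"
        using elim(2) balls by (metis norm_minus_commute)
      also have "\<dots> \<le> \<bar>l t\<bar> * norm (x t - y)"
        by (intro mult_right_mono) auto
      finally have g_le: "norm (g (t, y) - g (t, x t)) \<le> \<bar>l t\<bar> * norm (x t - y)" .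
      have "norm (f n (t, x t) - g (t, x t))
          \<le> norm (f n (t, x t) - f n (t, y)) + ?\<Delta> n y t + norm (g (t, y) - g (t, x t))"
        using norm_triangle_ineq[of "f n (t, x t) - f n (t, y)" "f n (t, y) - g (t, y)"]
          norm_triangle_ineq[of "f n (t, x t) - g (t, y)" "g (t, y) - g (t, x t)"]
        by simp
      also have "\<dots> \<le> \<rho> n t * norm (x t - y) + (\<Sum>y\<in>F. ?\<Delta> n y t) + \<bar>l t\<bar> * norm (x t - y)"
        by (intro add_mono f_le g_le member_le_sum y(1) F(2)) auto
      also have "\<dots> = (\<Sum>y\<in>F. ?\<Delta> n y t) + norm (x t - y) * (\<rho> n t + \<bar>l t\<bar>)"
        by (simp add: algebra_simps)
      also have "norm (x t - y) * (\<rho> n t + \<bar>l t\<bar>) \<le> \<delta> * (\<rho> n t + \<bar>l t\<bar>)"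
        using y(2) \<rho>(2)[of n t] by (intro mult_right_mono) (auto simp: dist_norm norm_minus_commute)
      finally show ?case
        by simp
    qed
    then have "p_norm p ?M (\<lambda>t. f n (t, x t) - g (t, x t)) \<le> p_norm p ?M ?V"
      by (intro p_norm_mono p p_integrable_add sum_int bound_int)
    also have "\<dots> \<le> p_norm p ?M (\<lambda>t. \<Sum>y\<in>F. ?\<Delta> n y t) + p_norm p ?M (\<lambda>t. \<delta> * (\<rho> n t + \<bar>l t\<bar>))"
      by (intro p_norm_add_le p sum_int bound_int)
    also have "p_norm p ?M (\<lambda>t. \<Sum>y\<in>F. ?\<Delta> n y t) \<le> (\<Sum>y\<in>F. p_norm p ?M (?\<Delta> n y))"
      by (intro p_norm_sum_le p F(2) \<Delta>_int)
    also have "p_norm p ?M (\<lambda>t. \<delta> * (\<rho> n t + \<bar>l t\<bar>)) = \<delta> * p_norm p ?M (\<lambda>t. \<rho> n t + \<bar>l t\<bar>)"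
      using \<delta>(1) p by (simp add: p_norm_cmult)
    also have "p_norm p ?M (\<lambda>t. \<rho> n t + \<bar>l t\<bar>) \<le> B"
      using p_norm_add_le[OF p \<rho>_int[of n] l_int] \<rho>_le[of n] by (simp add: B_def)
    finally show "p_norm p ?M (\<lambda>t. f n (t, x t) - g (t, x t))
        \<le> (\<Sum>y\<in>F. p_norm p ?M (\<lambda>t. f n (t, y) - g (t, y))) + e / 2"
      using \<delta> by (simp add: p_norm_of_norm mult_left_mono)
  qed
  have "(\<lambda>n. \<Sum>y\<in>F. p_norm p ?M (\<lambda>t. f n (t, y) - g (t, y))) \<longlonglongrightarrow> 0"
    using F(1) by (intro tendsto_null_sum conv) auto
  then have "\<forall>\<^sub>F n in sequentially. (\<Sum>y\<in>F. p_norm p ?M (\<lambda>t. f n (t, y) - g (t, y))) < e / 2"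
    using e by (intro order_tendstoD(2)) auto
  then obtain N where N: "\<And>n. n \<ge> N \<Longrightarrow> (\<Sum>y\<in>F. p_norm p ?M (\<lambda>t. f n (t, y) - g (t, y))) < e / 2"
    by (auto simp: eventually_sequentially)
  have "\<bar>curve_seminorm p {a..b} C (\<lambda>z. f n z - g z)\<bar> < e" if "n \<ge> N" for n
    using uniform[of n] N[OF that] curve_seminorm_nonneg[OF p LC_diff[OF p f g] C, of n] by simp
  then show "\<exists>N. \<forall>n\<ge>N. dist (curve_seminorm p {a..b} C (\<lambda>z. f n z - g z)) 0 < e"
    by auto
qed

section \<open>Construction of the limit\<close>

lemma borel_measurable_lebesgue_on:
  fixes u :: "real \<Rightarrow> 'b::euclidean_space"
  assumes "u \<in> borel_measurable borel"
  shows "u \<in> borel_measurable (lebesgue_on S)"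
  using assms by (intro measurable_restrict_space1 measurable_completion) simp

lemma Lp_loc_functionsI:
  fixes u :: "real \<Rightarrow> 'b::euclidean_space"
  assumes p: "1 \<le> p" and u: "u \<in> borel_measurable borel"
    and int: "\<And>m. integrable (lebesgue_on {- real m..real m}) (\<lambda>t. norm (u t) powr p)"
  shows "u \<in> Lp_loc_functions p"
  unfolding Lp_loc_functions_def
proof (intro CollectI allI conjI borel_measurable_lebesgue_on u)
  fix a b
  obtain m where m: "{a..b} \<subseteq> {- real m..real m}"
    using real_interval_subset by blast
  have "set_integrable lebesgue {- real m..real m} (\<lambda>t. norm (u t) powr p)"
    unfolding set_integrable_def using int[of m] by (intro integrable_restrict_space[THEN iffD1]) auto
  then have "set_integrable lebesgue {a..b} (\<lambda>t. norm (u t) powr p)"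
    by (rule set_integrable_subset) (use m in auto)
  then show "integrable (lebesgue_on {a..b}) (\<lambda>t. norm (u t) powr p)"
    unfolding set_integrable_def by (intro integrable_restrict_space[THEN iffD2]) auto
qed

text \<open>The approximation \<open>d k\<close> takes countably many values, so \<open>(t, x) \<mapsto> h (d k x) t\<close> is
  jointly measurable as soon as each \<open>h y\<close> is measurable.\<close>

lemma measurable_dense_approximation:
  fixes D :: "'a::euclidean_space set"
  assumes D: "countable D" "closure D = UNIV"
  obtains d :: "nat \<Rightarrow> 'a \<Rightarrow> 'a" where
    "\<And>k x. d k x \<in> D" "\<And>k x. dist (d k x) x < 1 / real (Suc k)"
    "\<And>k (h :: 'a \<Rightarrow> real \<Rightarrow> 'b::euclidean_space). (\<And>y. h y \<in> borel_measurable borel) \<Longrightarrow>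
      (\<lambda>z. h (d k (snd z)) (fst z)) \<in> borel_measurable borel"
proof -
  have "D \<noteq> {}"
    using D(2) by auto
  define e where "e = from_nat_into D"
  have e: "range e = D"
    unfolding e_def using \<open>D \<noteq> {}\<close> D(1) by (rule range_from_nat_into)
  define i where "i k x = (LEAST i. dist (e i) x < 1 / real (Suc k))" for k x
  have close: "dist (e (i k x)) x < 1 / real (Suc k)" for k x
  proof -
    have "x \<in> closure D"
      using D(2) by simp
    then obtain y where "y \<in> D" "dist y x < 1 / real (Suc k)"
      using closure_approachable[of x D] by (metis of_nat_0_less_iff zero_less_Suc zero_less_divide_1_iff)
    then obtain n where "dist (e n) x < 1 / real (Suc k)"
      using e by blast
    then show ?thesis
      unfolding i_def by (rule LeastI)
  qed
  have [measurable]: "i k \<in> measurable borel (count_space UNIV)" for k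
    unfolding i_def by measurable
  show ?thesis
  proof (rule that[of "\<lambda>k x. e (i k x)"])
    show "e (i k x) \<in> D" for k x
      using e by blast
    show "dist (e (i k x)) x < 1 / real (Suc k)" for k x
      by (rule close)
    fix k and h :: "'a \<Rightarrow> real \<Rightarrow> 'b"
    assume h: "\<And>y. h y \<in> borel_measurable borel"
    have fst_snd: "fst \<in> borel_measurable (borel :: (real \<times> 'a) measure)"
      "snd \<in> borel_measurable (borel :: (real \<times> 'a) measure)"
      by (intro borel_measurable_continuous_onI continuous_intros)+
    show "(\<lambda>z. h (e (i k (snd z))) (fst z)) \<in> borel_measurable borel"
    proof (rule measurable_compose_countable[where f = "\<lambda>n z. h (e n) (fst z)" and g = "\<lambda>z. i k (snd z)"])
      show "(\<lambda>z. h (e n) (fst z)) \<in> borel_measurable (borel :: (real \<times> 'a) measure)" for n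
        using fst_snd(1) h by (rule measurable_compose)
      show "(\<lambda>z. i k (snd z)) \<in> measurable (borel :: (real \<times> 'a) measure) (count_space UNIV)"
        using fst_snd(2) by (rule measurable_compose) simp
    qed
  qed
qed

text \<open>The extension is written as an explicit limit along the approximations \<open>d k\<close>, so that it
  inherits measurability in a parameter. The constant for radius \<open>j + 1\<close> serves points
  of norm at most \<open>j\<close>, because their approximations may leave the ball of radius \<open>j\<close>.\<close>

lemma lipschitz_extension_from_dense:
  fixes h :: "'a::real_normed_vector \<Rightarrow> 'b::banach" and d :: "nat \<Rightarrow> 'a \<Rightarrow> 'a"
  assumes lipschitz: "\<And>j x y. x \<in> D \<Longrightarrow> y \<in> D \<Longrightarrow> norm x \<le> real j \<Longrightarrow> norm y \<le> real j \<Longrightarrow>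
      norm (h x - h y) \<le> c j * norm (x - y)"
    and d: "\<And>k x. d k x \<in> D" "\<And>k x. dist (d k x) x < 1 / real (Suc k)"
  shows "x \<in> D \<Longrightarrow> lim (\<lambda>k. h (d k x)) = h x"
    and "norm x \<le> real j \<Longrightarrow> norm y \<le> real j \<Longrightarrow>
      norm (lim (\<lambda>k. h (d k x)) - lim (\<lambda>k. h (d k y))) \<le> c (Suc j) * norm (x - y)"
proof -
  have d_lim: "(\<lambda>k. d k x) \<longlonglongrightarrow> x" for x
  proof (rule metric_LIMSEQ_I)
    fix e :: real
    assume "0 < e"
    then obtain N where N: "1 / real (Suc N) < e"
      using nat_approx_posE by blast
    have "dist (d k x) x < e" if "k \<ge> N" for k
    proof -
      have "1 / real (Suc k) \<le> 1 / real (Suc N)"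
        using that by (intro divide_left_mono) auto
      then show ?thesis
        using d(2)[of k x] N by simp
    qed
    then show "\<exists>N. \<forall>k\<ge>N. dist (d k x) x < e"
      by blast
  qed
  have d_norm: "norm (d k x) \<le> real (Suc j)" if "norm x \<le> real j" for k x j
  proof -
    have "norm (d k x) \<le> norm x + dist (d k x) x"
      by (metis dist_norm norm_triangle_sub)
    also have "dist (d k x) x \<le> 1"
      using d(2)[of k x] by (rule order_trans[OF less_imp_le]) simp
    finally show ?thesis
      using that by simp
  qed
  have Cauchy: "Cauchy (\<lambda>k. h (d k x))" for x
  proof -
    obtain j where j: "norm x \<le> real j"
      using real_arch_simple by blast
    have "Cauchy (\<lambda>k. d k x)"
      using d_lim by (rule LIMSEQ_imp_Cauchy)
    show ?thesis
      unfolding Cauchy_def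
    proof (intro allI impI)
      fix e :: real
      assume e: "0 < e"
      define b where "b = \<bar>c (Suc j)\<bar> + 1"
      have b: "0 < b"
        by (simp add: b_def)
      then obtain N where N: "\<And>k l. k \<ge> N \<Longrightarrow> l \<ge> N \<Longrightarrow> dist (d k x) (d l x) < e / b"
        using \<open>Cauchy (\<lambda>k. d k x)\<close> e unfolding Cauchy_def by (metis divide_pos_pos)
      have "dist (h (d k x)) (h (d l x)) < e" if "k \<ge> N" "l \<ge> N" for k l
      proof -
        have "dist (h (d k x)) (h (d l x)) \<le> c (Suc j) * dist (d k x) (d l x)"
          unfolding dist_norm by (intro lipschitz d d_norm j)
        also have "\<dots> \<le> b * dist (d k x) (d l x)"
          by (intro mult_right_mono) (auto simp: b_def)
        also have "\<dots> < e"
          using N[OF that] b by (simp add: field_simps)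
        finally show ?thesis .
      qed
      then show "\<exists>N. \<forall>k\<ge>N. \<forall>l\<ge>N. dist (h (d k x)) (h (d l x)) < e"
        by blast
    qed
  qed
  have lim: "(\<lambda>k. h (d k x)) \<longlonglongrightarrow> lim (\<lambda>k. h (d k x))" for x
    using Cauchy Cauchy_convergent convergent_LIMSEQ_iff by blast
  show "norm (lim (\<lambda>k. h (d k x)) - lim (\<lambda>k. h (d k y))) \<le> c (Suc j) * norm (x - y)"
    if "norm x \<le> real j" "norm y \<le> real j"
  proof (rule LIMSEQ_le)
    show "(\<lambda>k. norm (h (d k x) - h (d k y))) \<longlonglongrightarrow> norm (lim (\<lambda>k. h (d k x)) - lim (\<lambda>k. h (d k y)))"
      by (intro tendsto_intros lim)
    show "(\<lambda>k. c (Suc j) * norm (d k x - d k y)) \<longlonglongrightarrow> c (Suc j) * norm (x - y)"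
      by (intro tendsto_intros d_lim)
    show "\<exists>N. \<forall>k\<ge>N. norm (h (d k x) - h (d k y)) \<le> c (Suc j) * norm (d k x - d k y)"
      using that by (intro exI[of _ 0] allI impI lipschitz d d_norm)
  qed
  show "lim (\<lambda>k. h (d k x)) = h x" if x: "x \<in> D"
  proof -
    obtain j where j: "norm x \<le> real j"
      using real_arch_simple by blast
    have "(\<lambda>k. h (d k x) - h x) \<longlonglongrightarrow> 0"
    proof (rule Lim_null_comparison)
      show "\<forall>\<^sub>F k in sequentially. norm (h (d k x) - h x) \<le> c (Suc j) * norm (d k x - x)"
        using j by (intro always_eventually allI lipschitz d x d_norm) auto
      have "(\<lambda>k. c (Suc j) * norm (d k x - x)) \<longlonglongrightarrow> c (Suc j) * norm (x - x)"
        by (intro tendsto_intros d_lim)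
      then show "(\<lambda>k. c (Suc j) * norm (d k x - x)) \<longlonglongrightarrow> 0"
        by simp
    qed
    then show ?thesis
      by (intro limI) (simp add: LIM_zero_iff)
  qed
qed

text \<open>Fatou's lemma: the bounds \<open>\<rho> n\<close> need not converge, but their lower limit is locally
  \<open>p\<close>-integrable, and a Lipschitz estimate that holds along the sequence passes to the limit with
  the lower limit as its constant.\<close>

lemma liminf_bound:
  fixes \<rho> :: "nat \<Rightarrow> real \<Rightarrow> real"
  assumes p: "1 \<le> p" and \<rho>: "\<And>n. \<rho> n \<in> borel_measurable borel" "\<And>n t. 0 \<le> \<rho> n t"
    and bounded: "\<And>m. \<exists>K\<ge>0. \<forall>n. (\<integral>\<^sup>+t. ennreal (\<rho> n t powr p) \<partial>lebesgue_on {- real m..real m}) \<le> ennreal K"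
  obtains l where "l \<in> Lp_loc_functions p"
    "AE t in lebesgue. \<forall>a A. (\<forall>n. a n \<le> \<rho> n t) \<longrightarrow> (\<forall>n. 0 \<le> a n) \<longrightarrow> a \<longlonglongrightarrow> A \<longrightarrow> A \<le> l t"
proof -
  define V where "V t = liminf (\<lambda>n. ennreal (\<rho> n t powr p))" for t
  have [measurable]: "\<rho> n \<in> borel_measurable borel" for n
    by (rule \<rho>)
  have V_meas[measurable]: "V \<in> borel_measurable borel"
    unfolding V_def by measurable
  have V_int: "(\<integral>\<^sup>+t. V t \<partial>lebesgue_on {- real m..real m}) < \<infinity>" for m
  proof -
    let ?M = "lebesgue_on {- real m..real m}"
    obtain K where K: "\<And>n. (\<integral>\<^sup>+t. ennreal (\<rho> n t powr p) \<partial>?M) \<le> ennreal K"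
      using bounded by blast
    have "(\<lambda>t. ennreal (\<rho> n t powr p)) \<in> borel_measurable ?M" for n
      by (intro measurable_restrict_space1 measurable_completion) simp
    then have "(\<integral>\<^sup>+t. V t \<partial>?M) \<le> liminf (\<lambda>n. \<integral>\<^sup>+t. ennreal (\<rho> n t powr p) \<partial>?M)"
      unfolding V_def by (rule nn_integral_liminf)
    also have "\<dots> \<le> liminf (\<lambda>n. ennreal K)"
      using K by (intro Liminf_mono always_eventually) auto
    also have "\<dots> < \<infinity>"
      by (simp add: Liminf_const)
    finally show ?thesis .
  qed
  have V_meas': "V \<in> borel_measurable (lebesgue_on S)" for S
    by (intro measurable_restrict_space1 measurable_completion) simp
  have V_finite: "AE t in lebesgue. V t < \<infinity>"
  proof (rule AE_eq_if_intervals)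
    show "AE t in lebesgue_on {- real m..real m}. V t < \<infinity>" for m
      using nn_integral_PInf_AE[OF V_meas', of "{- real m..real m}"] V_int[of m]
      by (auto simp: less_top)
  qed
  \<comment> \<open>The value 0 of \<open>enn2real\<close> at infinity only matters on the null set where \<open>V\<close> is infinite.\<close>
  define l where "l t = enn2real (V t) powr (1 / p)" for t
  have l_meas: "l \<in> borel_measurable borel"
    unfolding l_def by measurable
  have l_powr: "norm (l t) powr p = enn2real (V t)" for t
    using p by (simp add: l_def powr_powr)
  show ?thesis
  proof (rule that[of l])
    show "l \<in> Lp_loc_functions p"
    proof (rule Lp_loc_functionsI[OF p l_meas])
      fix m
      let ?M = "lebesgue_on {- real m..real m}"
      have "(\<integral>\<^sup>+t. ennreal (norm (enn2real (V t))) \<partial>?M) \<le> (\<integral>\<^sup>+t. V t \<partial>?M)"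
        by (intro nn_integral_mono) (simp add: ennreal_enn2real_if)
      then have "(\<integral>\<^sup>+t. ennreal (norm (enn2real (V t))) \<partial>?M) < \<infinity>"
        using V_int[of m] by (rule order_le_less_trans)
      then show "integrable ?M (\<lambda>t. norm (l t) powr p)"
        unfolding l_powr using V_meas' by (intro integrableI_bounded) auto
    qed
    show "AE t in lebesgue. \<forall>a A. (\<forall>n. a n \<le> \<rho> n t) \<longrightarrow> (\<forall>n. 0 \<le> a n) \<longrightarrow> a \<longlonglongrightarrow> A \<longrightarrow> A \<le> l t"
      using V_finite
    proof eventually_elim
      case (elim t)
      show ?case
      proof (intro allI impI)
        fix a A
        assume le: "\<forall>n. a n \<le> \<rho> n t" and nonneg: "\<forall>n. 0 \<le> a n" and lim: "a \<longlonglongrightarrow> A"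
        have A: "0 \<le> A"
          using lim nonneg by (intro LIMSEQ_le_const) auto
        have "(\<lambda>n. a n powr p) \<longlonglongrightarrow> A powr p"
          using p nonneg by (intro tendsto_powr2[OF lim]) auto
        then have "(\<lambda>n. ennreal (a n powr p)) \<longlonglongrightarrow> ennreal (A powr p)"
          by (rule tendsto_ennrealI)
        then have "ennreal (A powr p) = liminf (\<lambda>n. ennreal (a n powr p))"
          by (intro lim_imp_Liminf[symmetric]) auto
        also have "\<dots> \<le> V t"
          unfolding V_def using le nonneg p
          by (intro Liminf_mono always_eventually allI ennreal_leI powr_mono2) auto
        finally have "A powr p \<le> enn2real (V t)"
          using elim by (cases "V t") auto
        then have "(A powr p) powr (1 / p) \<le> l t"
          using p unfolding l_def by (intro powr_mono2) auto
        then show "A \<le> l t"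
          using p A by (simp add: powr_powr)
      qed
    qed
  qed
qed

text \<open>The limits on the countably many lines through \<open>D\<close> are glued together: for almost every
  \<open>t\<close> they form a locally Lipschitz function on \<open>D\<close>, which extends to the whole space. Its
  Lipschitz constants come from Fatou's lemma.\<close>

lemma limit_in_LC_functions:
  fixes f :: "nat \<Rightarrow> real \<times> (real ^ 'n) \<Rightarrow> real ^ 'm" and \<rho> :: "nat \<Rightarrow> nat \<Rightarrow> real \<Rightarrow> real"
  assumes p: "1 \<le> p" and D: "countable D" "closure D = UNIV"
    and f: "\<And>n. f n \<in> LC_functions p"
    and \<rho>: "\<And>j n. \<rho> j n \<in> borel_measurable borel" "\<And>j n t. 0 \<le> \<rho> j n t"
    and lipschitz: "\<And>j n. AE t in lebesgue. \<forall>x\<in>cball 0 (real j). \<forall>y\<in>cball 0 (real j).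
      norm (f n (t, x) - f n (t, y)) \<le> \<rho> j n t * norm (x - y)"
    and bounded: "\<And>j m. \<exists>K\<ge>0. \<forall>n. (\<integral>\<^sup>+t. ennreal (\<rho> j n t powr p) \<partial>lebesgue_on {- real m..real m}) \<le> ennreal K"
    and conv: "\<And>x m. x \<in> D \<Longrightarrow> \<exists>u. p_integrable p (lebesgue_on {- real m..real m}) u \<and>
      (\<lambda>n. p_norm p (lebesgue_on {- real m..real m}) (\<lambda>t. f n (t, x) - u t)) \<longlonglongrightarrow> 0 \<and>
      (AE t in lebesgue_on {- real m..real m}. (\<lambda>n. f n (t, x)) \<longlonglongrightarrow> u t)"
  obtains g where "g \<in> LC_functions p"
    "\<And>x m. x \<in> D \<Longrightarrow> (\<lambda>n. p_norm p (lebesgue_on {- real m..real m}) (\<lambda>t. f n (t, x) - g (t, x))) \<longlonglongrightarrow> 0"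
proof -
  define h where "h x t = lim (\<lambda>n. f n (t, x))" for x t
  have slice_meas: "(\<lambda>t. f n (t, x)) \<in> borel_measurable borel" for n x
    by (intro measurable_compose[OF _ LC_borel_measurable[OF f]] borel_measurable_continuous_onI
        continuous_intros)
  have h_meas: "h x \<in> borel_measurable borel" for x
    unfolding h_def using slice_meas by (rule borel_measurable_lim_metric)
  have h_AE: "AE t in lebesgue. (\<lambda>n. f n (t, x)) \<longlonglongrightarrow> h x t" if x: "x \<in> D" for x
  proof (rule AE_eq_if_intervals)
    fix m
    obtain u where "AE t in lebesgue_on {- real m..real m}. (\<lambda>n. f n (t, x)) \<longlonglongrightarrow> u t"
      using conv[OF x] by blast
    then show "AE t in lebesgue_on {- real m..real m}. (\<lambda>n. f n (t, x)) \<longlonglongrightarrow> h x t"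
      unfolding h_def by eventually_elim (auto simp: limI)
  qed
  have h_conv: "p_integrable p (lebesgue_on {- real m..real m}) (h x) \<and>
      (\<lambda>n. p_norm p (lebesgue_on {- real m..real m}) (\<lambda>t. f n (t, x) - h x t)) \<longlonglongrightarrow> 0"
    if x: "x \<in> D" for x m
  proof -
    let ?M = "lebesgue_on {- real m..real m}"
    obtain u where u: "p_integrable p ?M u" "(\<lambda>n. p_norm p ?M (\<lambda>t. f n (t, x) - u t)) \<longlonglongrightarrow> 0"
      "AE t in ?M. (\<lambda>n. f n (t, x)) \<longlonglongrightarrow> u t"
      using conv[OF x] by blast
    have eq: "AE t in ?M. h x t = u t"
      using u(3) unfolding h_def by eventually_elim (rule limI)
    then have h_int: "p_integrable p ?M (h x)"
      by (intro p_integrable_bound[OF p u(1)] borel_measurable_lebesgue_on h_meas)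
        (auto elim: eventually_mono)
    have f_int: "p_integrable p ?M (\<lambda>t. f n (t, x))" for n
      using LC_slice_in_Lp_loc[OF p f] by (simp add: Lp_loc_functions_iff)
    have "p_norm p ?M (\<lambda>t. f n (t, x) - h x t) = p_norm p ?M (\<lambda>t. f n (t, x) - u t)" for n
      using eq by (intro p_norm_cong_AE p p_integrable_diff f_int h_int u(1))
        (auto elim: eventually_mono)
    with h_int u(2) show ?thesis
      by simp
  qed
  have h_Lp: "h x \<in> Lp_loc_functions p" if "x \<in> D" for x
    using h_conv[OF that] by (intro Lp_loc_functionsI p h_meas) (auto simp: p_integrable_def)
  have "\<exists>l. l \<in> Lp_loc_functions p \<and>
      (AE t in lebesgue. \<forall>a A. (\<forall>n. a n \<le> \<rho> j n t) \<longrightarrow> (\<forall>n. 0 \<le> a n) \<longrightarrow> a \<longlonglongrightarrow> A \<longrightarrow> A \<le> l t)" for j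
    by (rule liminf_bound[OF p, of "\<rho> j"]) (use \<rho> bounded in blast)+
  then have "\<exists>l. \<forall>j. l j \<in> Lp_loc_functions p \<and>
      (AE t in lebesgue. \<forall>a A. (\<forall>n. a n \<le> \<rho> j n t) \<longrightarrow> (\<forall>n. 0 \<le> a n) \<longrightarrow> a \<longlonglongrightarrow> A \<longrightarrow> A \<le> l j t)"
    by (intro choice allI)
  then obtain l where l: "\<And>j. l j \<in> Lp_loc_functions p"
    and l_limit: "\<And>j. AE t in lebesgue. \<forall>a A. (\<forall>n. a n \<le> \<rho> j n t) \<longrightarrow> (\<forall>n. 0 \<le> a n) \<longrightarrow> a \<longlonglongrightarrow> A \<longrightarrow> A \<le> l j t"
    by blast
  have "AE t in lebesgue. \<forall>x\<in>D. (\<lambda>n. f n (t, x)) \<longlonglongrightarrow> h x t"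
    using D(1) h_AE by (simp add: AE_ball_countable)
  moreover have "AE t in lebesgue. \<forall>j n. \<forall>x\<in>cball 0 (real j). \<forall>y\<in>cball 0 (real j).
      norm (f n (t, x) - f n (t, y)) \<le> \<rho> j n t * norm (x - y)"
    unfolding AE_all_countable using lipschitz by blast
  moreover have "AE t in lebesgue. \<forall>j a A. (\<forall>n. a n \<le> \<rho> j n t) \<longrightarrow> (\<forall>n. 0 \<le> a n) \<longrightarrow> a \<longlonglongrightarrow> A \<longrightarrow> A \<le> l j t"
    unfolding AE_all_countable[where P = "\<lambda>j t. \<forall>a A. (\<forall>n. a n \<le> \<rho> j n t) \<longrightarrow> (\<forall>n. 0 \<le> a n) \<longrightarrow> a \<longlonglongrightarrow> A \<longrightarrow> A \<le> l j t"]
    using l_limit by blast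
  ultimately have h_lipschitz: "AE t in lebesgue. \<forall>j. \<forall>x\<in>D. \<forall>y\<in>D. norm x \<le> real j \<longrightarrow> norm y \<le> real j \<longrightarrow>
      norm (h x t - h y t) \<le> l j t * norm (x - y)"
  proof eventually_elim
    case (elim t)
    show ?case
    proof (intro allI ballI impI)
      fix j x y
      assume xy: "x \<in> D" "y \<in> D" "norm x \<le> real j" "norm y \<le> real j"
      show "norm (h x t - h y t) \<le> l j t * norm (x - y)"
      proof (cases "x = y")
        case False
        let ?a = "\<lambda>n. norm (f n (t, x) - f n (t, y)) / norm (x - y)"
        have "?a n \<le> \<rho> j n t" for n
          using elim(2) xy False by (simp add: pos_divide_le_eq)
        moreover have "?a \<longlonglongrightarrow> norm (h x t - h y t) / norm (x - y)"
          using elim(1) xy False by (intro tendsto_intros) auto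
        ultimately have "norm (h x t - h y t) / norm (x - y) \<le> l j t"
          using elim(3)[rule_format, of ?a j] by simp
        then show ?thesis
          using False by (simp add: pos_divide_le_eq)
      qed simp
    qed
  qed
  obtain d :: "nat \<Rightarrow> real ^ 'n \<Rightarrow> real ^ 'n" where d: "\<And>k x. d k x \<in> D" "\<And>k x. dist (d k x) x < 1 / real (Suc k)"
    and d_meas: "\<And>k (h :: _ \<Rightarrow> real \<Rightarrow> real ^ 'm). (\<And>y. h y \<in> borel_measurable borel) \<Longrightarrow>
      (\<lambda>z. h (d k (snd z)) (fst z)) \<in> borel_measurable borel"
    by (rule measurable_dense_approximation[OF D]) blast
  define g where "g z = lim (\<lambda>k. h (d k (snd z)) (fst z))" for z
  have g_meas: "g \<in> borel_measurable borel"
    unfolding g_def by (intro borel_measurable_lim_metric d_meas h_meas)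
  have g: "AE t in lebesgue. (\<forall>x\<in>D. g (t, x) = h x t) \<and>
      (\<forall>j x y. norm x \<le> real j \<longrightarrow> norm y \<le> real j \<longrightarrow> norm (g (t, x) - g (t, y)) \<le> l (Suc j) t * norm (x - y))"
    using h_lipschitz
  proof eventually_elim
    case (elim t)
    then show ?case
      using lipschitz_extension_from_dense[where h = "\<lambda>x. h x t" and c = "\<lambda>j. l j t" and D = D and d = d] d
      unfolding g_def by auto
  qed
  have g_LC: "g \<in> LC_functions p"
    unfolding LC_functions_def
  proof (intro CollectI conjI allI impI)
    show "g \<in> borel_measurable borel"
      by (rule g_meas)
    fix K :: "(real ^ 'n) set"
    assume "compact K"
    obtain x0 where x0: "x0 \<in> D"
      using d(1) by blast
    have "bounded (insert x0 K)"
      using \<open>compact K\<close> by (simp add: compact_imp_bounded)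
    then obtain b where b: "\<And>x. x \<in> insert x0 K \<Longrightarrow> norm x \<le> b"
      unfolding bounded_iff by blast
    obtain j where "b \<le> real j"
      using real_arch_simple by blast
    with b have j: "norm x \<le> real j" if "x \<in> insert x0 K" for x
      using that order_trans by blast
    show "\<exists>l\<in>Lp_loc_functions p. AE t in lebesgue. \<forall>x\<in>K. \<forall>y\<in>K. norm (g (t, x) - g (t, y)) \<le> l t * norm (x - y)"
    proof (intro bexI)
      show "AE t in lebesgue. \<forall>x\<in>K. \<forall>y\<in>K. norm (g (t, x) - g (t, y)) \<le> l (Suc j) t * norm (x - y)"
        using g by eventually_elim (use j in blast)
    qed (rule l)
    let ?m = "\<lambda>t. norm (h x0 t) + 2 * real j * \<bar>l (Suc j) t\<bar>"
    show "\<exists>m\<in>Lp_loc_functions p. AE t in lebesgue. \<forall>x\<in>K. norm (g (t, x)) \<le> m t"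
    proof (intro bexI[of _ ?m])
      have "(\<lambda>t. norm (h x0 t)) \<in> Lp_loc_functions p"
        using h_Lp[OF x0] by (simp add: Lp_loc_functions_iff p_integrable_norm)
      moreover have "(\<lambda>t. 2 * real j * norm (l (Suc j) t)) \<in> Lp_loc_functions p"
        using l[of "Suc j"] unfolding Lp_loc_functions_iff by (intro allI p_integrable_cmult p_integrable_norm) simp
      ultimately show "?m \<in> Lp_loc_functions p"
        using Lp_loc_add[OF p] by fastforce
      show "AE t in lebesgue. \<forall>x\<in>K. norm (g (t, x)) \<le> ?m t"
        using g
      proof eventually_elim
        case (elim t)
        show ?case
        proof
          fix x
          assume x: "x \<in> K"
          have "norm (g (t, x)) \<le> norm (g (t, x0)) + norm (g (t, x) - g (t, x0))"
            by (rule norm_triangle_sub)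
          also have "norm (g (t, x) - g (t, x0)) \<le> l (Suc j) t * norm (x - x0)"
            using elim x j by blast
          also have "\<dots> \<le> \<bar>l (Suc j) t\<bar> * norm (x - x0)"
            by (intro mult_right_mono) auto
          also have "\<dots> \<le> \<bar>l (Suc j) t\<bar> * (2 * real j)"
            using j[of x] j[of x0] x norm_triangle_ineq4[of x x0] by (intro mult_left_mono) auto
          finally show "norm (g (t, x)) \<le> ?m t"
            using elim x0 by (simp add: mult.commute)
        qed
      qed
    qed
  qed
  show ?thesis
  proof (rule that[OF g_LC])
    fix x m
    assume x: "x \<in> D"
    let ?M = "lebesgue_on {- real m..real m}"
    have slice: "p_integrable p ?M (\<lambda>t. q (t, x))" if "q \<in> LC_functions p" for q :: "real \<times> (real ^ 'n) \<Rightarrow> real ^ 'm"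
      using LC_slice_in_Lp_loc[OF p that] by (simp add: Lp_loc_functions_iff)
    have "AE t in lebesgue. g (t, x) = h x t"
      using g by eventually_elim (use x in blast)
    then have "AE t in ?M. g (t, x) = h x t"
      by (rule AE_lebesgue_on)
    then have "p_norm p ?M (\<lambda>t. f n (t, x) - g (t, x)) = p_norm p ?M (\<lambda>t. f n (t, x) - h x t)" for n
      using h_conv[OF x] by (intro p_norm_cong_AE p p_integrable_diff slice f g_LC) (auto elim: eventually_mono)
    then show "(\<lambda>n. p_norm p ?M (\<lambda>t. f n (t, x) - g (t, x))) \<longlonglongrightarrow> 0"
      using h_conv[OF x] by simp
  qed
qed

section \<open>The compactness criterion\<close>

text \<open>Diagonal argument over the pairs of a point of \<open>D\<close> and an interval \<open>[-m, m]\<close>. Besides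
  convergence in norm, each step secures pointwise convergence almost everywhere, which the
  construction of the limit needs in order to pass Lipschitz bounds to it.\<close>

lemma subsequence_converging_on_dense:
  fixes D :: "(real ^ 'n) set" and F :: "nat \<Rightarrow> (real \<times> (real ^ 'n) \<Rightarrow> real ^ 'm) set"
  assumes p: "1 \<le> p" and D: "countable D" and E: "E \<subseteq> LC_space p"
    and compact: "\<And>x. x \<in> D \<Longrightarrow> relatively_compact_in (Lp_loc_topology p) (slice p x ` E)"
    and F: "\<And>n. F n \<in> E"
  obtains r :: "nat \<Rightarrow> nat" where "strict_mono r"
    "\<And>x m. x \<in> D \<Longrightarrow> \<exists>u. p_integrable p (lebesgue_on {- real m..real m}) u \<and>
      (\<lambda>n. p_norm p (lebesgue_on {- real m..real m}) (\<lambda>t. representative (F (r n)) (t, x) - u t)) \<longlonglongrightarrow> 0 \<and>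
      (AE t in lebesgue_on {- real m..real m}. (\<lambda>n. representative (F (r n)) (t, x)) \<longlonglongrightarrow> u t)"
proof (cases "D = {}")
  case True
  then show ?thesis
    using that[of id] by (simp add: strict_mono_id)
next
  case False
  define f where "f n = representative (F n)" for n
  have f: "f n \<in> LC_functions p" for n
    unfolding f_def using F E by (intro LC_representative) auto
  define e where "e = from_nat_into D"
  have e: "e i \<in> D" for i
    unfolding e_def using False by (rule from_nat_into)
  define conv where "conv x m s u \<longleftrightarrow> p_integrable p (lebesgue_on {- real m..real m}) u \<and>
      (\<lambda>n. p_norm p (lebesgue_on {- real m..real m}) (\<lambda>t. f (s n) (t, x) - u t)) \<longlonglongrightarrow> 0 \<and>
      (AE t in lebesgue_on {- real m..real m}. (\<lambda>n. f (s n) (t, x)) \<longlonglongrightarrow> u t)"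
    for x and m :: nat and s :: "nat \<Rightarrow> nat" and u
  have f_int: "p_integrable p (lebesgue_on {a..b}) (\<lambda>t. f n (t, x))" for n a b x
    using LC_slice_in_Lp_loc[OF p f] by (simp add: Lp_loc_functions_iff)
  have conv_subseq: "conv x m (s \<circ> r) u" if "strict_mono r" "conv x m s u" for x m s r u
    using that LIMSEQ_subseq_LIMSEQ[OF _ that(1), of "\<lambda>n. p_norm p (lebesgue_on {- real m..real m}) (\<lambda>t. f (s n) (t, x) - u t)"]
      LIMSEQ_subseq_LIMSEQ[OF _ that(1), of "\<lambda>n. f (s n) (_, x)"]
    unfolding conv_def o_def by (auto elim!: eventually_mono)
  have ex_conv: "\<exists>r u. strict_mono r \<and> conv x m (s \<circ> r) u" if x: "x \<in> D" for x m and s :: "nat \<Rightarrow> nat"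
  proof -
    let ?M = "lebesgue_on {- real m..real m}"
    define S where "S n = slice p x (F (s n))" for n
    have S: "AE t in lebesgue. representative (S n) t = f (s n) (t, x)" for n
      unfolding S_def f_def using F E by (intro slice_class(2)[OF p]) auto
    have S_class: "S n \<in> Lp_loc_space p" for n
      unfolding S_def using F E by (intro slice_class(1)[OF p]) auto
    have "range S \<subseteq> slice p x ` E"
      using F by (auto simp: S_def)
    from compact[OF x, unfolded relatively_compact_in_Lp_loc_iff[OF p], THEN conjunct2, rule_format, OF this]
    obtain r1 L where r1: "strict_mono r1" and L: "L \<in> Lp_loc_space p"
      and "\<forall>m. (\<lambda>n. p_norm p (lebesgue_on {- real m..real m})
        (\<lambda>t. representative (S (r1 n)) t - representative L t)) \<longlonglongrightarrow> 0"
      by (elim exE conjE) (rule that)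
    then have lim: "(\<lambda>n. p_norm p ?M (\<lambda>t. representative (S (r1 n)) t - representative L t)) \<longlonglongrightarrow> 0"
      by blast
    define u where "u = representative L"
    have u_int: "p_integrable p ?M u"
      using Lp_loc_representative[OF L] by (simp add: u_def Lp_loc_functions_iff)
    have S_int: "p_integrable p ?M (representative (S n))" for n
      using Lp_loc_representative[OF S_class] by (simp add: Lp_loc_functions_iff)
    have "p_norm p ?M (\<lambda>t. representative (S (r1 n)) t - u t) = p_norm p ?M (\<lambda>t. f (s (r1 n)) (t, x) - u t)" for n
      using AE_lebesgue_on[where a = "- real m" and b = "real m", OF S[of "r1 n"]]
      by (intro p_norm_cong_AE p p_integrable_diff S_int f_int u_int) (auto elim: eventually_mono)
    then have lim': "(\<lambda>n. p_norm p ?M (\<lambda>t. f (s (r1 n)) (t, x) - u t)) \<longlonglongrightarrow> 0"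
      using lim by (simp add: u_def)
    obtain r2 :: "nat \<Rightarrow> nat" where r2: "strict_mono r2"
      and AE: "AE t in ?M. (\<lambda>n. f (s (r1 (r2 n))) (t, x) - u t) \<longlonglongrightarrow> 0"
      using p_norm_tendsto_0_imp_AE_subseq[OF p p_integrable_diff[OF p f_int u_int] lim'] by blast
    have "(\<lambda>n. p_norm p ?M (\<lambda>t. f (s (r1 (r2 n))) (t, x) - u t)) \<longlonglongrightarrow> 0"
      using LIMSEQ_subseq_LIMSEQ[OF lim' r2] by (simp add: o_def)
    moreover have "AE t in ?M. (\<lambda>n. f (s (r1 (r2 n))) (t, x)) \<longlonglongrightarrow> u t"
      using AE by eventually_elim (rule LIM_zero_cancel)
    ultimately have "conv x m (s \<circ> (r1 \<circ> r2)) u"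
      using u_int by (simp add: conv_def)
    then show ?thesis
      using strict_mono_o[OF r1 r2] by blast
  qed
  define P where "P k s \<longleftrightarrow> (\<exists>u. conv (e (fst (prod_decode k))) (snd (prod_decode k)) s u)" for k s
  interpret subseqs P
    by unfold_locales (use ex_conv e in \<open>auto simp: P_def\<close>)
  have stable: "P k (s \<circ> r)" if "strict_mono r" "P k s" for k s r
    using that conv_subseq unfolding P_def by blast
  show ?thesis
  proof (rule that[OF subseq_diagseq])
    fix x m
    assume "x \<in> D"
    then obtain i where i: "x = e i"
      unfolding e_def using D by (metis from_nat_into_surj)
    define k where "k = prod_encode (i, m)"
    have "P k (diagseq \<circ> (+) (Suc k))"
      by (rule diagseq_holds) (rule stable)
    then obtain u where "conv x m (\<lambda>n. diagseq (n + Suc k)) u"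
      by (auto simp: P_def k_def i o_def add.commute)
    then have "conv x m diagseq u"
      unfolding conv_def
      using LIMSEQ_offset[where k = "Suc k" and f = "\<lambda>n. p_norm p (lebesgue_on {- real m..real m}) (\<lambda>t. f (diagseq n) (t, x) - u t)"]
        LIMSEQ_offset[where k = "Suc k" and f = "\<lambda>n. f (diagseq n) (_, x)"]
      by (auto elim!: eventually_mono)
    then show "\<exists>u. p_integrable p (lebesgue_on {- real m..real m}) u \<and>
      (\<lambda>n. p_norm p (lebesgue_on {- real m..real m}) (\<lambda>t. representative (F (diagseq n)) (t, x) - u t)) \<longlonglongrightarrow> 0 \<and>
      (AE t in lebesgue_on {- real m..real m}. (\<lambda>n. representative (F (diagseq n)) (t, x)) \<longlonglongrightarrow> u t)"
      unfolding conv_def f_def by blast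
  qed
qed

text \<open>The hypothesis on \<open>E\<close> integrates an optimal bound that need not be measurable. It is used only
  through monotonicity of the integral, which passes the bound on to any smaller function.\<close>

lemma uniform_integral_bound:
  assumes bounded: "Lp_loc_bounded_l_bounds p E"
  obtains K where "0 \<le> K"
    "\<And>F u. F \<in> E \<Longrightarrow> (\<And>t. u t \<le> ennreal_powr (l_bound (representative F) j t) p) \<Longrightarrow>
      (\<integral>\<^sup>+t. u t \<partial>lebesgue_on {a..b}) \<le> ennreal K"
proof -
  obtain m where m: "{a..b} \<subseteq> {- real m..real m}"
    using real_interval_subset by blast
  \<comment> \<open>The successor keeps the radius positive when \<open>m = 0\<close>.\<close>
  let ?J = "{- real (Suc m)..real (Suc m)}"
  let ?S = "SUP F\<in>E. \<integral>\<^sup>+t\<in>?J. ennreal_powr (l_bound (representative F) j t) p \<partial>lebesgue"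
  have "?S < \<infinity>"
    by (rule bounded[unfolded Lp_loc_bounded_l_bounds_def, rule_format]) simp
  then have S: "ennreal (enn2real ?S) = ?S"
    by simp
  show ?thesis
  proof (rule that[of "enn2real ?S"])
    show "0 \<le> enn2real ?S"
      by simp
    fix F u
    assume F: "F \<in> E" and u: "\<And>t. u t \<le> ennreal_powr (l_bound (representative F) j t) p"
    have "{a..b} \<subseteq> ?J"
      using m by (auto simp: subset_eq)
    have "(\<integral>\<^sup>+t. u t \<partial>lebesgue_on {a..b}) = (\<integral>\<^sup>+t\<in>{a..b}. u t \<partial>lebesgue)"
      by (rule nn_integral_restrict_space) simp
    also have "\<dots> \<le> (\<integral>\<^sup>+t\<in>?J. ennreal_powr (l_bound (representative F) j t) p \<partial>lebesgue)"
      using \<open>{a..b} \<subseteq> ?J\<close> u by (intro nn_integral_mono mult_mono) (auto simp: indicator_def subset_eq)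
    also have "\<dots> \<le> ?S"
      using F by (rule SUP_upper)
    finally show "(\<integral>\<^sup>+t. u t \<partial>lebesgue_on {a..b}) \<le> ennreal (enn2real ?S)"
      by (simp only: S)
  qed
qed

text \<open>A limit of a subsequence in \<open>curve_topology p \<C>\<close> has as its slice at \<open>x \<in> D\<close> a limit of the
  slices, because the seminorms of the topology control the norms along the constant curve \<open>x\<close>.\<close>

lemma compact_slices_if_relatively_compact:
  fixes D :: "(real ^ 'n) set" and E :: "(real \<times> (real ^ 'n) \<Rightarrow> real ^ 'm) set set"
  assumes p: "1 \<le> p" and D: "countable D" "closure D = UNIV" and \<C>: "curve_family D \<C>"
    and compact: "relatively_compact_in (curve_topology p \<C>) E" and x: "x \<in> D"
  shows "relatively_compact_in (Lp_loc_topology p) (slice p x ` E)"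
  unfolding relatively_compact_in_Lp_loc_iff[OF p]
proof (intro conjI allI impI)
  have E: "E \<subseteq> LC_space p"
    using compact unfolding relatively_compact_in_curve_topology_iff[OF p D \<C>] by blast
  then show "slice p x ` E \<subseteq> Lp_loc_space p"
    using slice_class(1)[OF p] by blast
  fix S :: "nat \<Rightarrow> (real \<Rightarrow> real ^ 'm) set"
  assume "range S \<subseteq> slice p x ` E"
  then have "\<forall>n. \<exists>F. F \<in> E \<and> S n = slice p x F"
    by blast
  then obtain F where F: "\<And>n. F n \<in> E" and S: "\<And>n. S n = slice p x (F n)"
    by metis
  then have "range F \<subseteq> E"
    by blast
  from compact[unfolded relatively_compact_in_curve_topology_iff[OF p D \<C>], THEN conjunct2, rule_format, OF this]
  obtain r L where r: "strict_mono r" and L: "L \<in> LC_space p"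
    and lim: "\<forall>(I, C)\<in>\<C>. (\<lambda>n. curve_seminorm p I C (\<lambda>z. representative (F (r n)) z - representative L z)) \<longlonglongrightarrow> 0"
    by (elim exE conjE) (rule that)
  have "(\<lambda>n. p_norm p (lebesgue_on {- real m..real m})
      (\<lambda>t. representative (S (r n)) t - representative (slice p x L) t)) \<longlonglongrightarrow> 0" for m
  proof -
    let ?I = "{- real m..real m}"
    obtain C where C: "(?I, C) \<in> \<C>" "(\<lambda>_. x) \<in> C"
      using \<C> x interval_in_rational_intervals[of m] unfolding curve_family_def by blast
    then obtain j where j: "C \<subseteq> continuous_curves ?I j"
      using \<C> unfolding curve_family_def by fast
    have le: "p_norm p (lebesgue_on ?I) (\<lambda>t. representative (S (r n)) t - representative (slice p x L) t)
        \<le> curve_seminorm p ?I C (\<lambda>z. representative (F (r n)) z - representative L z)" for n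
    proof -
      have FE: "F (r n) \<in> LC_space p"
        using F E by blast
      have diff: "(\<lambda>z. representative (F (r n)) z - representative L z) \<in> LC_functions p"
        by (intro LC_diff[OF p] LC_representative FE L)
      have "AE t in lebesgue. norm (representative (S (r n)) t - representative (slice p x L) t)
          \<le> norm (representative (F (r n)) (t, x) - representative L (t, x))"
        using slice_class(2)[OF p FE, of x] slice_class(2)[OF p L, of x] unfolding S
        by eventually_elim simp
      then have "p_norm p (lebesgue_on ?I) (\<lambda>t. representative (S (r n)) t - representative (slice p x L) t)
          \<le> p_norm p (lebesgue_on ?I) (\<lambda>t. representative (F (r n)) (t, x) - representative L (t, x))"
        using LC_slice_in_Lp_loc[OF p diff]
        by (intro p_norm_mono[OF p] AE_lebesgue_on) (auto simp: Lp_loc_functions_iff)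
      also have "\<dots> \<le> curve_seminorm p ?I C (\<lambda>z. representative (F (r n)) z - representative L z)"
        using curve_p_norm_le_curve_seminorm[OF p diff j C(2)] by simp
      finally show ?thesis .
    qed
    have "(\<lambda>n. curve_seminorm p ?I C (\<lambda>z. representative (F (r n)) z - representative L z)) \<longlonglongrightarrow> 0"
      using lim C(1) by blast
    then show ?thesis
      by (rule tendsto_0_squeeze[OF p_norm_nonneg le])
  qed
  then show "\<exists>r L. strict_mono r \<and> L \<in> Lp_loc_space p \<and>
      (\<forall>m. (\<lambda>n. p_norm p (lebesgue_on {- real m..real m})
        (\<lambda>t. representative (S (r n)) t - representative L t)) \<longlonglongrightarrow> 0)"
    using r slice_class(1)[OF p L] by blast
qed

text \<open>A subsequence that converges on all lines through \<open>D\<close> has a limit in \<open>LC_functions p\<close> by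
  Fatou's lemma. Since the Lipschitz bounds of its members are bounded in \<open>p\<close>-norm, it also
  converges to this limit uniformly along curves.\<close>

lemma relatively_compact_if_compact_slices:
  fixes D :: "(real ^ 'n) set" and E :: "(real \<times> (real ^ 'n) \<Rightarrow> real ^ 'm) set set"
  assumes p: "1 \<le> p" and D: "countable D" "closure D = UNIV" and \<C>: "curve_family D \<C>"
    and E: "E \<subseteq> LC_space p" and bounded: "Lp_loc_bounded_l_bounds p E"
    and compact: "\<And>x. x \<in> D \<Longrightarrow> relatively_compact_in (Lp_loc_topology p) (slice p x ` E)"
  shows "relatively_compact_in (curve_topology p \<C>) E"
  unfolding relatively_compact_in_curve_topology_iff[OF p D \<C>]
proof (intro conjI allI impI)
  show "E \<subseteq> LC_space p"
    by (rule E)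
  fix F :: "nat \<Rightarrow> (real \<times> (real ^ 'n) \<Rightarrow> real ^ 'm) set"
  assume "range F \<subseteq> E"
  then have F: "F n \<in> E" for n
    by blast
  obtain r :: "nat \<Rightarrow> nat" where r: "strict_mono r"
    and conv: "\<And>x m. x \<in> D \<Longrightarrow> \<exists>u. p_integrable p (lebesgue_on {- real m..real m}) u \<and>
      (\<lambda>n. p_norm p (lebesgue_on {- real m..real m}) (\<lambda>t. representative (F (r n)) (t, x) - u t)) \<longlonglongrightarrow> 0 \<and>
      (AE t in lebesgue_on {- real m..real m}. (\<lambda>n. representative (F (r n)) (t, x)) \<longlonglongrightarrow> u t)"
    by (rule subsequence_converging_on_dense[OF p D(1) E compact F]) (assumption | rule that)+
  define f where "f n = representative (F (r n))" for n
  have f: "f n \<in> LC_functions p" for n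
    unfolding f_def using F E by (intro LC_representative) auto
  define lip where "lip j n \<rho> \<longleftrightarrow> \<rho> \<in> borel_measurable borel \<and> (\<forall>t. 0 \<le> \<rho> t) \<and>
      (AE t in lebesgue. \<forall>x\<in>cball 0 (real j). \<forall>y\<in>cball 0 (real j).
        norm (f n (t, x) - f n (t, y)) \<le> \<rho> t * norm (x - y)) \<and>
      (\<forall>t. ennreal (\<rho> t powr p) \<le> ennreal_powr (l_bound (f n) j t) p)" for j n and \<rho> :: "real \<Rightarrow> real"
  have "\<exists>\<rho>. lip j n \<rho>" for j n
    by (rule measurable_lipschitz_bound[OF p f[of n] D, of j]) (auto simp: lip_def)
  then obtain \<rho> where "\<And>j n. lip j n (\<rho> j n)"
    by metis
  then have \<rho>: "\<And>j n. \<rho> j n \<in> borel_measurable borel" "\<And>j n t. 0 \<le> \<rho> j n t"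
    and lipschitz: "\<And>j n. AE t in lebesgue. \<forall>x\<in>cball 0 (real j). \<forall>y\<in>cball 0 (real j).
        norm (f n (t, x) - f n (t, y)) \<le> \<rho> j n t * norm (x - y)"
    and \<rho>_le: "\<And>j n t. ennreal (\<rho> j n t powr p) \<le> ennreal_powr (l_bound (f n) j t) p"
    unfolding lip_def by blast+
  have K: "\<exists>K\<ge>0. \<forall>n. (\<integral>\<^sup>+t. ennreal (\<rho> j n t powr p) \<partial>lebesgue_on {a..b}) \<le> ennreal K" for j a b
  proof -
    obtain K where K: "0 \<le> K"
      "\<And>F u. F \<in> E \<Longrightarrow> (\<And>t. u t \<le> ennreal_powr (l_bound (representative F) j t) p) \<Longrightarrow>
        (\<integral>\<^sup>+t. u t \<partial>lebesgue_on {a..b}) \<le> ennreal K"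
      using uniform_integral_bound[OF bounded, of j a b] by blast
    have "(\<integral>\<^sup>+t. ennreal (\<rho> j n t powr p) \<partial>lebesgue_on {a..b}) \<le> ennreal K" for n
      by (rule K(2)[OF F \<rho>_le[unfolded f_def]])
    with K(1) show ?thesis
      by blast
  qed
  obtain g where g: "g \<in> LC_functions p"
    and g_lim: "\<And>x m. x \<in> D \<Longrightarrow>
      (\<lambda>n. p_norm p (lebesgue_on {- real m..real m}) (\<lambda>t. f n (t, x) - g (t, x))) \<longlonglongrightarrow> 0"
    by (rule limit_in_LC_functions[OF p D f \<rho> lipschitz K conv[folded f_def]]) (assumption | rule that)+
  define L where "L = LC_rel p `` {g}"
  have L: "L \<in> LC_space p"
    unfolding L_def LC_space_def using g by (rule quotientI)
  let ?g = "representative L"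
  have g': "?g \<in> LC_functions p"
    using L by (rule LC_representative)
  have "AE z in lebesgue. g z = ?g z"
  proof -
    have "(g, ?g) \<in> LC_rel p"
      unfolding L_def by (rule representative_of_class[OF equiv_LC_rel g])
    then show ?thesis
      by (simp add: LC_rel_def)
  qed
  then have eq: "AE t in lebesgue. \<forall>x. g (t, x) = ?g (t, x)"
    by (rule LC_AE_eq_slices[OF g g'])
  have L_lim: "(\<lambda>n. p_norm p (lebesgue_on {a..b}) (\<lambda>t. f n (t, x) - ?g (t, x))) \<longlonglongrightarrow> 0" if x: "x \<in> D" for x a b
  proof -
    obtain m where m: "{a..b} \<subseteq> {- real m..real m}"
      using real_interval_subset by blast
    have le: "p_norm p (lebesgue_on {a..b}) (\<lambda>t. f n (t, x) - ?g (t, x))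
        \<le> p_norm p (lebesgue_on {- real m..real m}) (\<lambda>t. f n (t, x) - g (t, x))" for n
    proof -
      have diff: "(\<lambda>t. f n (t, x) - g (t, x)) \<in> Lp_loc_functions p"
        using LC_slice_in_Lp_loc[OF p LC_diff[OF p f g]] by simp
      have "AE t in lebesgue. norm (f n (t, x) - ?g (t, x)) \<le> norm (f n (t, x) - g (t, x))"
        using eq by eventually_elim simp
      then have "p_norm p (lebesgue_on {a..b}) (\<lambda>t. f n (t, x) - ?g (t, x))
          \<le> p_norm p (lebesgue_on {a..b}) (\<lambda>t. f n (t, x) - g (t, x))"
        using diff by (intro p_norm_mono[OF p] AE_lebesgue_on) (auto simp: Lp_loc_functions_iff)
      also have "\<dots> \<le> p_norm p (lebesgue_on {- real m..real m}) (\<lambda>t. f n (t, x) - g (t, x))"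
        by (rule p_norm_mono_interval[OF p diff m])
      finally show ?thesis .
    qed
    show ?thesis
      by (rule tendsto_0_squeeze[OF p_norm_nonneg le g_lim[OF x]])
  qed
  have "(\<lambda>n. curve_seminorm p I C (\<lambda>z. f n z - ?g z)) \<longlonglongrightarrow> 0" if IC: "(I, C) \<in> \<C>" for I C
  proof -
    obtain a b j where I: "I = {a..b}" and C: "C \<subseteq> continuous_curves {a..b} j" "C \<noteq> {}"
      using IC \<C> unfolding curve_family_def rational_intervals_def by fast
    obtain K' where "0 \<le> K'" "\<And>n. (\<integral>\<^sup>+t. ennreal (\<rho> (Suc j) n t powr p) \<partial>lebesgue_on {a..b}) \<le> ennreal K'"
      using K by blast
    then show ?thesis
      unfolding I by (rule curve_convergence_if_dense_convergence[OF p D(2) f g' \<rho> lipschitz _ _ L_lim C])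
  qed
  then show "\<exists>r L. strict_mono r \<and> L \<in> LC_space p \<and>
      (\<forall>(I, C)\<in>\<C>. (\<lambda>n. curve_seminorm p I C (\<lambda>z. representative (F (r n)) z - representative L z)) \<longlonglongrightarrow> 0)"
    using r L unfolding f_def by blast
qed

theorem theorem4p14:
  fixes p :: real
    and E :: "(real \<times> (real ^ 'n) \<Rightarrow> real ^ 'm) set set"
    and D :: "(real ^ 'n) set"
    and T :: "(real \<times> (real ^ 'n) \<Rightarrow> real ^ 'm) set topology"
  assumes "1 \<le> p"
    and "E \<subseteq> LC_space p"
    and "Lp_loc_bounded_l_bounds p E"
    and "countable D" and "closure D = UNIV"
    and "T = T_D p D \<or> (\<exists>\<theta>. suitable_moduli \<theta> \<and> T = T_Theta p \<theta>) \<or> T = T_B p"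
  shows "relatively_compact_in T E \<longleftrightarrow>
    (\<forall>x\<in>D. relatively_compact_in (Lp_loc_topology p) (slice p x ` E))"
proof -
  obtain \<C> where \<C>: "curve_family D \<C>" and T: "T = curve_topology p \<C>"
    using topology_from_curve_family[OF assms(4,6)] by blast
  show ?thesis
    unfolding T
    using compact_slices_if_relatively_compact[OF assms(1,4,5) \<C>]
      relatively_compact_if_compact_slices[OF assms(1,4,5) \<C> assms(2,3)]
    by blast
qed

end
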